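(* Let $2\le n_1<n_2<n_3$ be integers with $\frac{\log n_2}{\log n_3}<\frac{\log n_1}{\log n_2}$, and let $F\subset[0,1]^3$ be the Bedford--McMullen sponge generated by a set $\mathcal{D}\subset\mathcal{I}_1\times\mathcal{I}_2\times\mathcal{I}_3$ with at least two elements; assume that $F$ has non-uniform fibres. Then, with $f_1,f_2,f_4,g_1,g_2,g_4$ the functions on $(0,1)$ defined in the context, the Assouad spectrum of $F$ is $$\dim_{\mathrm A}^{\theta}F=\begin{cases} f_1(\theta) & \text{for } 0<\theta\le\frac{\log n_1}{\log n_3},\\ f_2(\theta) & \text{for } \frac{\log n_1}{\log n_3}<\theta\le\frac{\log n_2}{\log n_3},\\ f_4(\theta) & \text{for } \frac{\log n_2}{\log n_3}<\theta\le\frac{\log n_1}{\log n_2},\\ \dim_{\mathrm A}F & \text{for } \frac{\log n_1}{\log n_2}<\theta<1,\end{cases}$$ and the lower spectrum of $F$ is $$\dim_{\mathrm L}^{\theta}F=\begin{cases} g_1(\theta) & \text{for } 0<\theta\le\frac{\log n_1}{\log n_3},\\ g_2(\theta) & \text{for } \frac{\log n_1}{\log n_3}<\theta\le\frac{\log n_2}{\log n_3},\\ g_4(\theta) & \text{for } \frac{\log n_2}{\log n_3}<\theta\le\frac{\log n_1}{\log n_2},\\ \dim_{\mathrm L}F & \text{for } \frac{\log n_1}{\log n_2}<\theta<1.\end{cases}$$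
   Context: **Dimensions.** For bounded $E\subset\mathbb{R}^d$ and $r>0$, $N(E,r)$ is the minimal number of balls of radius $r$ required to cover $E$; $B(x,R)$ is the closed ball with centre $x$ and radius $R$. Let $F\subset\mathbb{R}^d$ be non-empty and compact. - Box dimension: $\dim_{\mathrm B}F=\lim_{r\to0}\frac{\log N(F,r)}{\log(1/r)}$ when the limit exists (it does for Bedford--McMullen sponges). - Assouad dimension: $\dim_{\mathrm A}F$ is the infimum of all $s>0$ for which there is $C>0$ such that $N(B(x,R)\cap F,r)\le C(R/r)^s$ for all $x\in F$ and $0<r<R$. - Lower dimension: $\dim_{\mathrm L}F$ is the supremum of all $s>0$ for which there is $C>0$ such that $N(B(x,R)\cap F,r)\ge C(R/r)^s$ for all $x\in F$ and $0<r<R<1$. - For $\theta\in(0,1)$, the Assouad spectrum $\dim_{\mathrm A}^{\theta}F$ is the infimum of all $s>0$ for which there is $C>0$ such that $N(B(x,R)\cap F,R^{1/\theta})\le C(R/R^{1/\theta})^s$ for all $0<R<1$ and $x\in F$. - For $\theta\in(0,1)$, the lower spectrum $\dim_{\mathrm L}^{\theta}F$ is the supremum of all $s>0$ for which there is $C>0$ such that $N(B(x,R)\cap F,R^{1/\theta})\ge C(R/R^{1/\theta})^s$ for all $0<R<1$ and $x\in F$. The supremum of the empty set is taken to be $0$. **Bedford--McMullen sponges.** Let $2\le n_1<\dots<n_d$ be integers, $\mathcal{I}_q=\{0,\dots,n_q-1\}$, and let $\mathcal{D}\subset\prod_{q=1}^d\mathcal{I}_q$ have at least two elements. For $\bar\imath=(i_1,\dots,i_d)\in\mathcal{D}$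 let $\varphi_{\bar\imath}(x_1,\dots,x_d)=\left(\frac{x_1+i_1}{n_1},\dots,\frac{x_d+i_d}{n_d}\right)$ on $[0,1]^d$. Let $\mathcal{D}^\infty$ be the set of infinite words $\omega=(\bar\imath_1,\bar\imath_2,\dots)$ over $\mathcal{D}$ and $\Pi(\omega)$ the unique point of $\bigcap_{l\in\mathbb{N}}\varphi_{\bar\imath_1}\circ\cdots\circ\varphi_{\bar\imath_l}([0,1]^d)$. The Bedford--McMullen sponge generated by $\mathcal{D}$ is $F=\Pi(\mathcal{D}^\infty)$. For $1\le l\le d$, $\pi_l$ denotes projection of $\mathcal{D}$ onto the first $l$ coordinates, and for $1\le l\le d-1$ and $(i_1,\dots,i_l)\in\pi_l\mathcal{D}$, $$N(i_1,\dots,i_l)=|\{i_{l+1}\in\mathcal{I}_{l+1}:(i_1,\dots,i_l,i_{l+1})\in\pi_{l+1}\mathcal{D}\}|.$$ $F$ has uniform fibres if for every $l=1,\dots,d-1$ the number $N(i_1,\dots,i_l)$ is the same for all $(i_1,\dots,i_l)\in\pi_l\mathcal{D}$; otherwise it has non-uniform fibres. **Notation for $d=3$.** $M_{\max}$, $M_{\min}$ are the maximum and minimum of $N(i_1)$ over $i_1\in\pi_1\mathcal{D}$; $N_{\max}$, $N_{\min}$ are the maximum and minimum of $N(i_1,i_2)$ over $(i_1,i_2)\in\pi_2\mathcal{D}$; $C_{\max}$, $C_{\min}$ are the maximum and minimum over $i_1\in\pi_1\mathcal{D}$ of $\sum_{i_2:(i_1,i_2)\in\pi_2\mathcal{D}}N(i_1,i_2)$.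 For $\theta\in(0,1)$, $$f_1(\theta)=\frac{\dim_{\mathrm B}F-\theta\left(\frac{\log(|\mathcal{D}|/C_{\max})}{\log n_1}+\frac{\log(C_{\max}/N_{\max})}{\log n_2}+\frac{\log N_{\max}}{\log n_3}\right)}{1-\theta},$$ $$f_2(\theta)=\frac{\frac{\log|\pi_1\mathcal{D}|}{\log n_1}+\frac{\log(|\pi_2\mathcal{D}|/|\pi_1\mathcal{D}|)}{\log n_2}+\frac{\log(C_{\max}/M_{\max})}{\log n_3}-\theta\left(\frac{\log(|\pi_2\mathcal{D}|/M_{\max})}{\log n_1}+\frac{\log(C_{\max}/N_{\max})}{\log n_2}+\frac{\log N_{\max}}{\log n_3}\right)}{1-\theta},$$ $$f_4(\theta)=\frac{\frac{\log|\pi_1\mathcal{D}|}{\log n_1}+\frac{\log(|\pi_2\mathcal{D}|/|\pi_1\mathcal{D}|)}{\log n_2}-\theta\left(\frac{\log(|\pi_2\mathcal{D}|/M_{\max})}{\log n_1}+\frac{\log M_{\max}}{\log n_2}\right)}{1-\theta}+\frac{\log N_{\max}}{\log n_3},$$ and $g_1,g_2,g_4$ are given by the same formulae as $f_1,f_2,f_4$ respectively, with $C_{\max},M_{\max},N_{\max}$ replaced throughout by $C_{\min},M_{\min},N_{\min}$. *)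

theory Defs
  imports "HOL-Analysis.Analysis"
begin

section \<open>Dimensions\<close>

text \<open>Covering balls are closed and their centres are arbitrary points of the space.\<close>

definition covering_number :: "'a::metric_space set \<Rightarrow> real \<Rightarrow> nat" where
  "covering_number E r =
     (LEAST k. \<exists>A. finite A \<and> card A = k \<and> E \<subseteq> (\<Union>a\<in>A. cball a r))"

definition box_dim :: "'a::metric_space set \<Rightarrow> real" where
  "box_dim F = Lim (at_right 0) (\<lambda>r. ln (real (covering_number F r)) / ln (1 / r))"

definition assouad_dim :: "'a::metric_space set \<Rightarrow> real" where
  "assouad_dim F = Inf {s. s > 0 \<and> (\<exists>C>0. \<forall>x\<in>F. \<forall>r R. 0 < r \<and> r < R \<longrightarrow>
      real (covering_number (cball x R \<inter> F) r) \<le> C * (R / r) powr s)}"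

text \<open>In the two suprema below the element 0 is inserted because the supremum of the
  empty set is taken to be 0, whereas it is unspecified for the type \<^typ>\<open>real\<close>.\<close>

definition lower_dim :: "'a::metric_space set \<Rightarrow> real" where
  "lower_dim F = Sup (insert 0 {s. s > 0 \<and> (\<exists>C>0. \<forall>x\<in>F. \<forall>r R. 0 < r \<and> r < R \<and> R < 1 \<longrightarrow>
      real (covering_number (cball x R \<inter> F) r) \<ge> C * (R / r) powr s)})"

definition assouad_spectrum :: "real \<Rightarrow> 'a::metric_space set \<Rightarrow> real" where
  "assouad_spectrum \<theta> F = Inf {s. s > 0 \<and> (\<exists>C>0. \<forall>R. 0 < R \<and> R < 1 \<longrightarrow> (\<forall>x\<in>F.
      real (covering_number (cball x R \<inter> F) (R powr (1 / \<theta>)))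
        \<le> C * (R / R powr (1 / \<theta>)) powr s))}"

definition lower_spectrum :: "real \<Rightarrow> 'a::metric_space set \<Rightarrow> real" where
  "lower_spectrum \<theta> F = Sup (insert 0 {s. s > 0 \<and> (\<exists>C>0. \<forall>R. 0 < R \<and> R < 1 \<longrightarrow> (\<forall>x\<in>F.
      real (covering_number (cball x R \<inter> F) (R powr (1 / \<theta>)))
        \<ge> C * (R / R powr (1 / \<theta>)) powr s))})"


section \<open>Bedford--McMullen sponges\<close>

text \<open>A digit vector is a function from the coordinate indices to \<^typ>\<open>nat\<close>; digits start at 0.\<close>

definition digit_box :: "('d \<Rightarrow> nat) \<Rightarrow> ('d \<Rightarrow> nat) set" where
  "digit_box n = {i. \<forall>q. i q < n q}"

definition contraction :: "('d::finite \<Rightarrow> nat) \<Rightarrow> ('d \<Rightarrow> nat) \<Rightarrow> real ^ 'd \<Rightarrow> real ^ 'd" where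
  "contraction n i x = (\<chi> q. (x $ q + real (i q)) / real (n q))"

text \<open>The composition of the first \<open>l\<close> contractions along the word \<open>\<omega>\<close>, the first letter
  being applied last.\<close>

primrec word_map ::
  "('d::finite \<Rightarrow> nat) \<Rightarrow> (nat \<Rightarrow> 'd \<Rightarrow> nat) \<Rightarrow> nat \<Rightarrow> real ^ 'd \<Rightarrow> real ^ 'd" where
  "word_map n \<omega> 0 = id"
| "word_map n \<omega> (Suc l) = word_map n \<omega> l \<circ> contraction n (\<omega> l)"

definition unit_cube :: "(real ^ 'd) set" where
  "unit_cube = {x. \<forall>q. 0 \<le> x $ q \<and> x $ q \<le> 1}"

definition coding_map :: "('d::finite \<Rightarrow> nat) \<Rightarrow> (nat \<Rightarrow> 'd \<Rightarrow> nat) \<Rightarrow> real ^ 'd" where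
  "coding_map n \<omega> = (THE x. x \<in> (\<Inter>l. word_map n \<omega> l ` unit_cube))"

definition sponge :: "('d::finite \<Rightarrow> nat) \<Rightarrow> ('d \<Rightarrow> nat) set \<Rightarrow> (real ^ 'd) set" where
  "sponge n D = coding_map n ` {\<omega>. \<forall>l. \<omega> l \<in> D}"


section \<open>Three-dimensional digit sets\<close>

text \<open>The coordinates are \<open>1\<close>, \<open>2\<close> and \<open>3\<close>, the elements of the type \<^typ>\<open>3\<close>.\<close>

definition proj1 :: "(3 \<Rightarrow> nat) set \<Rightarrow> nat set" where
  "proj1 D = (\<lambda>i. i 1) ` D"

definition proj2 :: "(3 \<Rightarrow> nat) set \<Rightarrow> (nat \<times> nat) set" where
  "proj2 D = (\<lambda>i. (i 1, i 2)) ` D"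

text \<open>\<open>fibre1 D i1\<close> is $N(i_1)$ and \<open>fibre2 D (i1, i2)\<close> is $N(i_1, i_2)$. For digit sets inside
  \<open>digit_box n\<close> the counted digits automatically lie in the right range.\<close>

definition fibre1 :: "(3 \<Rightarrow> nat) set \<Rightarrow> nat \<Rightarrow> nat" where
  "fibre1 D i1 = card {i2. (i1, i2) \<in> proj2 D}"

definition fibre2 :: "(3 \<Rightarrow> nat) set \<Rightarrow> nat \<times> nat \<Rightarrow> nat" where
  "fibre2 D p = card {i3. \<exists>i\<in>D. (i 1, i 2) = p \<and> i 3 = i3}"

definition uniform_fibres :: "(3 \<Rightarrow> nat) set \<Rightarrow> bool" where
  "uniform_fibres D \<longleftrightarrow>
     (\<forall>a\<in>proj1 D. \<forall>b\<in>proj1 D. fibre1 D a = fibre1 D b) \<and>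
     (\<forall>p\<in>proj2 D. \<forall>q\<in>proj2 D. fibre2 D p = fibre2 D q)"

definition column_sum :: "(3 \<Rightarrow> nat) set \<Rightarrow> nat \<Rightarrow> nat" where
  "column_sum D i1 = (\<Sum>i2 | (i1, i2) \<in> proj2 D. fibre2 D (i1, i2))"

definition M_max :: "(3 \<Rightarrow> nat) set \<Rightarrow> nat" where
  "M_max D = Max (fibre1 D ` proj1 D)"

definition M_min :: "(3 \<Rightarrow> nat) set \<Rightarrow> nat" where
  "M_min D = Min (fibre1 D ` proj1 D)"

definition N_max :: "(3 \<Rightarrow> nat) set \<Rightarrow> nat" where
  "N_max D = Max (fibre2 D ` proj2 D)"

definition N_min :: "(3 \<Rightarrow> nat) set \<Rightarrow> nat" where
  "N_min D = Min (fibre2 D ` proj2 D)"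

definition C_max :: "(3 \<Rightarrow> nat) set \<Rightarrow> nat" where
  "C_max D = Max (column_sum D ` proj1 D)"

definition C_min :: "(3 \<Rightarrow> nat) set \<Rightarrow> nat" where
  "C_min D = Min (column_sum D ` proj1 D)"


section \<open>The functions describing the spectra\<close>

text \<open>The formulae take the extremal counts \<open>C\<close>, \<open>M\<close>, \<open>N\<close> as parameters: the maxima give
  $f_1, f_2, f_4$ and the minima give $g_1, g_2, g_4$.\<close>

definition spectrum_formula1 ::
  "(3 \<Rightarrow> nat) \<Rightarrow> (3 \<Rightarrow> nat) set \<Rightarrow> real \<Rightarrow> real \<Rightarrow> real \<Rightarrow> real" where
  "spectrum_formula1 n D C N \<theta> =
     (box_dim (sponge n D)
       - \<theta> * (ln (card D / C) / ln (n 1) + ln (C / N) / ln (n 2) + ln N / ln (n 3)))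
     / (1 - \<theta>)"

definition spectrum_formula2 ::
  "(3 \<Rightarrow> nat) \<Rightarrow> (3 \<Rightarrow> nat) set \<Rightarrow> real \<Rightarrow> real \<Rightarrow> real \<Rightarrow> real \<Rightarrow> real" where
  "spectrum_formula2 n D C M N \<theta> =
     (ln (card (proj1 D)) / ln (n 1) + ln (card (proj2 D) / card (proj1 D)) / ln (n 2)
         + ln (C / M) / ln (n 3)
       - \<theta> * (ln (card (proj2 D) / M) / ln (n 1) + ln (C / N) / ln (n 2) + ln N / ln (n 3)))
     / (1 - \<theta>)"

definition spectrum_formula4 ::
  "(3 \<Rightarrow> nat) \<Rightarrow> (3 \<Rightarrow> nat) set \<Rightarrow> real \<Rightarrow> real \<Rightarrow> real \<Rightarrow> real" where
  "spectrum_formula4 n D M N \<theta> =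
     (ln (card (proj1 D)) / ln (n 1) + ln (card (proj2 D) / card (proj1 D)) / ln (n 2)
       - \<theta> * (ln (card (proj2 D) / M) / ln (n 1) + ln M / ln (n 2)))
     / (1 - \<theta>) + ln N / ln (n 3)"

definition f1 :: "(3 \<Rightarrow> nat) \<Rightarrow> (3 \<Rightarrow> nat) set \<Rightarrow> real \<Rightarrow> real" where
  "f1 n D = spectrum_formula1 n D (C_max D) (N_max D)"

definition f2 :: "(3 \<Rightarrow> nat) \<Rightarrow> (3 \<Rightarrow> nat) set \<Rightarrow> real \<Rightarrow> real" where
  "f2 n D = spectrum_formula2 n D (C_max D) (M_max D) (N_max D)"

definition f4 :: "(3 \<Rightarrow> nat) \<Rightarrow> (3 \<Rightarrow> nat) set \<Rightarrow> real \<Rightarrow> real" where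
  "f4 n D = spectrum_formula4 n D (M_max D) (N_max D)"

definition g1 :: "(3 \<Rightarrow> nat) \<Rightarrow> (3 \<Rightarrow> nat) set \<Rightarrow> real \<Rightarrow> real" where
  "g1 n D = spectrum_formula1 n D (C_min D) (N_min D)"

definition g2 :: "(3 \<Rightarrow> nat) \<Rightarrow> (3 \<Rightarrow> nat) set \<Rightarrow> real \<Rightarrow> real" where
  "g2 n D = spectrum_formula2 n D (C_min D) (M_min D) (N_min D)"

definition g4 :: "(3 \<Rightarrow> nat) \<Rightarrow> (3 \<Rightarrow> nat) set \<Rightarrow> real \<Rightarrow> real" where
  "g4 n D = spectrum_formula4 n D (M_min D) (N_min D)"

end

theory Submission
  imports Defs
begin

text \<open>A scale \<open>r\<close> determines, in direction \<open>q\<close>, about \<open>log (1 / r) / log (n q)\<close> digits of a point of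
  the sponge; fixing exactly these digits gives an approximate cube of side \<open>r\<close>. A ball of radius \<open>R\<close>
  meets boundedly many approximate cubes of side \<open>R\<close>, so its covering number at scale \<open>r\<close> is comparable
  to the number of approximate cubes of side \<open>r\<close> inside one of side \<open>R\<close>. That number is a product over
  the digit positions, and the factor at a position depends only on the digit there and on which
  coordinates are determined at the two scales. As digits can be chosen position by position, the
  extremal counts are products of the extremal factors; their logarithms are piecewise linear in
  \<open>log (1 / R)\<close> and \<open>log (1 / r)\<close>, and the regimes in \<open>\<theta>\<close> correspond to the possible orders
  of the levels.

  For the minimum one must also prevent neighbouring approximate cubes from contributing. This is done by
  prescribing two digits per coordinate, which costs a bounded factor and moves the centre into the
  interior of its cell.\<close>

section \<open>Digit expansions\<close>

text \<open>Only logarithms of scales matter. Rounding them to integer levels changes the logarithm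
  of a count by a bounded amount, and the idealised logarithm is homogeneous, hence linear in
  log(1/R) along r = R^(1/\<theta>). So each spectrum is found for all \<theta> at once; the regimes
  enter only when the exponent is evaluated. The Assouad and lower dimensions are read off from the
  last regime. Digit counts are submultiplicative (maxima) or supermultiplicative (minima) when
  coordinates are released in stages, so releasing them one at a time gives an exponent valid for
  all pairs of scales. For \<theta> > log n_1 / log n_2 every position does release at most one
  coordinate, and the exponent is attained. The hypothesis on the logarithms puts log n_2 / log n_3
  below log n_1 / log n_2, which leaves exactly four orders of the levels. The digits prescribed for
  the minimum must not collide. This is why that construction is confined to small R, where the
  levels of the three directions have separated.\<close>

primrec prefix_num :: "nat \<Rightarrow> (nat \<Rightarrow> nat) \<Rightarrow> nat \<Rightarrow> nat" where
  "prefix_num b x 0 = 0"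
| "prefix_num b x (Suc l) = b * prefix_num b x l + x l"

lemma prefix_num_eqD:
  assumes "prefix_num b x l = prefix_num b y l" "\<And>k. x k < b" "\<And>k. y k < b" "k < l"
  shows "x k = y k"
  using assms(1,4)
proof (induction l)
  case (Suc l)
  have *: "(b * prefix_num b z l + z l) mod b = z l" "(b * prefix_num b z l + z l) div b = prefix_num b z l"
    if "z l < b" for z
    using that by simp_all
  have "x l = y l" "prefix_num b x l = prefix_num b y l"
    using Suc.prems(1) *[of x] *[of y] assms(2,3) by (metis prefix_num.simps(2))+
  then show ?case using Suc by (auto simp: less_Suc_eq)
qed simp

lemma prefix_num_cong:
  "(\<And>k. k < l \<Longrightarrow> x k = y k) \<Longrightarrow> prefix_num b x l = prefix_num b y l"
  by (induction l) auto

lemma prefix_num_lower_mono: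
  assumes "0 < b" "l \<le> l'"
  shows "real (prefix_num b x l) / real b ^ l \<le> prefix_num b x l' / real b ^ l'"
proof -
  have "incseq (\<lambda>l. real (prefix_num b x l) / real b ^ l)"
    using assms(1) by (intro incseq_SucI) (simp add: field_simps)
  then show ?thesis using assms(2) by (simp add: incseq_def)
qed

lemma prefix_num_upper_antimono:
  assumes "\<And>k. x k < b" "l \<le> l'"
  shows "(real (prefix_num b x l') + 1) / real b ^ l' \<le> (real (prefix_num b x l) + 1) / real b ^ l"
proof -
  have b: "0 < b" using assms(1)[of 0] by simp
  have "decseq (\<lambda>l. (real (prefix_num b x l) + 1) / real b ^ l)"
  proof (intro decseq_SucI)
    fix l
    have "b * prefix_num b x l + x l + 1 \<le> b * (prefix_num b x l + 1)"
      using assms(1)[of l] by (simp add: algebra_simps)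
    then have "real (b * prefix_num b x l + x l + 1) \<le> real (b * (prefix_num b x l + 1))"
      by (rule of_nat_mono)
    then have "real (prefix_num b x (Suc l)) + 1 \<le> real b * (real (prefix_num b x l) + 1)"
      by (simp only: prefix_num.simps of_nat_add of_nat_mult of_nat_1)
    then have "(real (prefix_num b x (Suc l)) + 1) / real b ^ Suc l
      \<le> (real b * (real (prefix_num b x l) + 1)) / real b ^ Suc l"
      by (intro divide_right_mono) auto
    then show "(real (prefix_num b x (Suc l)) + 1) / real b ^ Suc l \<le> (real (prefix_num b x l) + 1) / real b ^ l"
      using b by (simp add: add.commute)
  qed
  then show ?thesis using assms(2) by (simp add: decseq_def)
qed

lemma word_map_nth:
  assumes "\<And>q. 0 < n q"
  shows "word_map n \<omega> l x $ q = (x $ q + prefix_num (n q) (\<lambda>k. \<omega> k q) l) / real (n q) ^ l"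
proof (induction l arbitrary: x)
  case (Suc l)
  then show ?case using assms[of q] by (simp add: contraction_def field_simps)
qed simp

lemma word_map_unit_cube:
  assumes "\<And>q. 0 < n q"
  shows "word_map n \<omega> l ` unit_cube =
    {x. \<forall>q. real (prefix_num (n q) (\<lambda>k. \<omega> k q) l) / real (n q) ^ l \<le> x $ q \<and>
            x $ q \<le> (real (prefix_num (n q) (\<lambda>k. \<omega> k q) l) + 1) / real (n q) ^ l}" (is "_ = ?R")
proof (intro equalityI subsetI)
  fix y assume "y \<in> word_map n \<omega> l ` unit_cube"
  then show "y \<in> ?R"
    using assms by (auto simp: word_map_nth unit_cube_def intro!: divide_right_mono)
next
  fix y assume y: "y \<in> ?R"
  define x where "x = (\<chi> q. y $ q * real (n q) ^ l - prefix_num (n q) (\<lambda>k. \<omega> k q) l)"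
  have "x \<in> unit_cube"
    using y assms by (auto simp: x_def unit_cube_def field_simps)
  moreover have "word_map n \<omega> l x = y"
    using assms by (simp add: vec_eq_iff word_map_nth x_def less_imp_neq[symmetric])
  ultimately show "y \<in> word_map n \<omega> l ` unit_cube" by blast
qed

section \<open>Digit systems and the coding map\<close>

definition words :: "('d \<Rightarrow> nat) set \<Rightarrow> (nat \<Rightarrow> 'd \<Rightarrow> nat) set" where
  "words D = {\<omega>. \<forall>l. \<omega> l \<in> D}"

lemma sponge_eq: "sponge n D = coding_map n ` words D"
  by (simp add: sponge_def words_def)

locale digit_system =
  fixes n :: "'d::finite \<Rightarrow> nat" and D :: "('d \<Rightarrow> nat) set"
  assumes n_ge: "2 \<le> n q" and D_box: "D \<subseteq> digit_box n" and D_ne: "D \<noteq> {}"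
begin

lemma n_gt_1: "1 < real (n q)" and n_pos: "0 < n q" and ln_n_pos: "0 < ln (real (n q))"
  using n_ge[of q] by auto

lemma digit_less: "i \<in> D \<Longrightarrow> i q < n q"
  using D_box by (auto simp: digit_box_def)

lemma words_less: "\<omega> \<in> words D \<Longrightarrow> \<omega> k q < n q"
  by (auto simp: words_def digit_less)

lemma words_in: "\<omega> \<in> words D \<Longrightarrow> \<omega> k \<in> D"
  by (auto simp: words_def)

lemma words_ne: "words D \<noteq> {}"
  using D_ne by (auto simp: words_def)

lemma finite_D: "finite D"
proof (rule finite_subset)
  show "D \<subseteq> PiE UNIV (\<lambda>q. {..<n q})"
    by (auto simp: digit_less)
qed (auto intro: finite_PiE)

text \<open>Cells are nested, so every left end lies below every right end and the suprema of the
  left ends lie in all cells; a common point is unique because the sides tend to 0. This justifies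
  the description in \<open>coding_map\<close>.\<close>

lemma coding_map_bounds:
  assumes \<omega>: "\<omega> \<in> words D"
  shows "real (prefix_num (n q) (\<lambda>k. \<omega> k q) l) / real (n q) ^ l \<le> coding_map n \<omega> $ q"
    and "coding_map n \<omega> $ q \<le> (real (prefix_num (n q) (\<lambda>k. \<omega> k q) l) + 1) / real (n q) ^ l"
proof -
  define lo where "lo q l = real (prefix_num (n q) (\<lambda>k. \<omega> k q) l) / real (n q) ^ l" for q l
  define hi where "hi q l = (real (prefix_num (n q) (\<lambda>k. \<omega> k q) l) + 1) / real (n q) ^ l" for q l
  define P where "P x \<longleftrightarrow> (\<forall>l q. lo q l \<le> x $ q \<and> x $ q \<le> hi q l)" for x :: "real ^ 'd"
  have lohi: "lo q l \<le> hi q l'" for q l l'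
  proof -
    \<comment> \<open>The two levels are compared at their common refinement.\<close>
    have "lo q l \<le> lo q (max l l')"
      unfolding lo_def by (rule prefix_num_lower_mono) (simp_all add: n_pos)
    also have "\<dots> \<le> hi q (max l l')"
      unfolding lo_def hi_def by (intro divide_right_mono) auto
    also have "\<dots> \<le> hi q l'"
      unfolding hi_def using prefix_num_upper_antimono[of "\<lambda>k. \<omega> k q" "n q" l' "max l l'"] words_less[OF \<omega>]
      by (simp add: add.commute)
    finally show ?thesis .
  qed
  have ex: "P (\<chi> q. SUP l. lo q l)"
    unfolding P_def using lohi by (auto intro!: cSUP_upper cSUP_least bdd_aboveI2)
  have unique: "x = y" if "P x" "P y" for x y
  proof (rule ccontr)
    assume "x \<noteq> y"
    then obtain q where q: "x $ q \<noteq> y $ q" by (auto simp: vec_eq_iff)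
    have "\<bar>x $ q - y $ q\<bar> \<le> (1 / n q) ^ l" for l
    proof -
      have "hi q l - lo q l = (1 / n q) ^ l"
        by (simp add: hi_def lo_def add_divide_distrib power_one_over)
      moreover have "lo q l \<le> x $ q" "x $ q \<le> hi q l" "lo q l \<le> y $ q" "y $ q \<le> hi q l"
        using that by (auto simp: P_def)
      ultimately show ?thesis by linarith
    qed
    moreover obtain l where "(1 / real (n q)) ^ l < \<bar>x $ q - y $ q\<bar>"
      using real_arch_pow_inv[of "\<bar>x $ q - y $ q\<bar>" "1 / n q"] q n_gt_1[of q] by auto
    ultimately show False by (meson linorder_not_le)
  qed
  have "coding_map n \<omega> = (THE x. P x)"
    unfolding coding_map_def word_map_unit_cube[OF n_pos] P_def lo_def hi_def by simp
  then have "P (coding_map n \<omega>)"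
    using theI[of P, OF ex] unique ex by metis
  then show "real (prefix_num (n q) (\<lambda>k. \<omega> k q) l) / real (n q) ^ l \<le> coding_map n \<omega> $ q"
    and "coding_map n \<omega> $ q \<le> (real (prefix_num (n q) (\<lambda>k. \<omega> k q) l) + 1) / real (n q) ^ l"
    by (auto simp: P_def lo_def hi_def)
qed

end

section \<open>Cylinders and approximate cubes\<close>

definition agree :: "('d \<Rightarrow> nat) \<Rightarrow> (nat \<Rightarrow> 'd \<Rightarrow> nat) \<Rightarrow> (nat \<Rightarrow> 'd \<Rightarrow> nat) \<Rightarrow> bool" where
  "agree L \<omega> \<eta> \<longleftrightarrow> (\<forall>q. \<forall>k<L q. \<omega> k q = \<eta> k q)"

text \<open>Digits are stored by position, as extensional functions, because the letters of a word
  are independent while the coordinates of one letter are not. Sets of codes thus become dependent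
  products.\<close>

definition code :: "('d::finite \<Rightarrow> nat) \<Rightarrow> (nat \<Rightarrow> 'd \<Rightarrow> nat) \<Rightarrow> nat \<Rightarrow> 'd \<Rightarrow> nat" where
  "code L \<omega> = (\<lambda>k\<in>{..<Max (range L)}. restrict (\<omega> k) {q. k < L q})"

text \<open>The factor contributed by one position, where \<open>S\<close> and \<open>T\<close> are
  the coordinates determined at the coarse and at the fine scale. In dimension three,
  \<open>S = {1}\<close> and \<open>T = {1, 2}\<close> give N(i_1).\<close>

definition extensions :: "('d \<Rightarrow> nat) set \<Rightarrow> 'd set \<Rightarrow> 'd set \<Rightarrow> ('d \<Rightarrow> nat) \<Rightarrow> nat" where
  "extensions D S T i = card ((\<lambda>j. restrict j T) ` {j\<in>D. \<forall>q\<in>S. j q = i q})"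

lemma level_le_Max: "L q \<le> Max (range L)" for L :: "'d::finite \<Rightarrow> nat"
  by (intro Max_ge) auto

lemma code_eq_iff: "code L \<omega> = code L \<eta> \<longleftrightarrow> agree L \<omega> \<eta>"
proof
  assume eq: "code L \<omega> = code L \<eta>"
  have "\<omega> k q = \<eta> k q" if "k < L q" for k q
    using fun_cong[OF fun_cong[OF eq, of k], of q] that level_le_Max[of L q]
    by (simp add: code_def)
  then show "agree L \<omega> \<eta>" by (simp add: agree_def)
qed (auto simp: code_def agree_def fun_eq_iff restrict_def)

text \<open>All words over \<open>D\<close> are allowed, so agreement with \<open>\<omega>\<close>
  restricts each letter separately and the codes form a full product over the positions.\<close>

lemma card_codes_agreeing:
  assumes \<omega>: "\<omega> \<in> words D"
  shows "card (code L' ` {\<eta> \<in> words D. agree L \<omega> \<eta>}) =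
    (\<Prod>k<Max (range L'). extensions D {q. k < L q} {q. k < L' q} (\<omega> k))"
proof -
  define B where "B k = (\<lambda>j. restrict j {q. k < L' q}) ` {j\<in>D. \<forall>q\<in>{q. k < L q}. j q = \<omega> k q}" for k
  have "code L' ` {\<eta> \<in> words D. agree L \<omega> \<eta>} = PiE {..<Max (range L')} B"
  proof (intro equalityI subsetI)
    fix g assume "g \<in> code L' ` {\<eta> \<in> words D. agree L \<omega> \<eta>}"
    then show "g \<in> PiE {..<Max (range L')} B"
      by (auto simp: code_def B_def words_def agree_def)
  next
    fix g assume g: "g \<in> PiE {..<Max (range L')} B"
    have "\<exists>j. j \<in> D \<and> (\<forall>q. k < L q \<longrightarrow> j q = \<omega> k q) \<and>
        (k < Max (range L') \<longrightarrow> g k = restrict j {q. k < L' q})" for k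
    proof (cases "k < Max (range L')")
      case True
      then have "g k \<in> B k" using g by auto
      then show ?thesis by (auto simp: B_def)
    next
      \<comment> \<open>Beyond the recorded positions any compatible letter will do, for instance
        that of \<open>\<omega>\<close>.\<close>
      case False
      then show ?thesis using \<omega> by (auto simp: words_def)
    qed
    then obtain \<eta> where \<eta>: "\<eta> k \<in> D" "\<And>q. k < L q \<Longrightarrow> \<eta> k q = \<omega> k q"
      "k < Max (range L') \<Longrightarrow> g k = restrict (\<eta> k) {q. k < L' q}" for k by metis
    have "g = code L' \<eta>"
      using g \<eta>(3) by (auto simp: code_def fun_eq_iff PiE_def extensional_def)
    moreover have "\<eta> \<in> {\<eta> \<in> words D. agree L \<omega> \<eta>}"
      using \<eta>(1,2) by (auto simp: words_def agree_def)
    ultimately show "g \<in> code L' ` {\<eta> \<in> words D. agree L \<omega> \<eta>}" by blast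
  qed
  then show ?thesis by (simp add: card_PiE B_def extensions_def)
qed

section \<open>Finite images and covering numbers\<close>

lemma card_image_le_image:
  assumes "finite (g ` W)" "\<And>x y. x \<in> W \<Longrightarrow> y \<in> W \<Longrightarrow> g x = g y \<Longrightarrow> f x = f y"
  shows "finite (f ` W)" "card (f ` W) \<le> card (g ` W)"
proof -
  have "f ` W \<subseteq> (\<lambda>v. f (inv_into W g v)) ` (g ` W)"
  proof
    fix y assume "y \<in> f ` W"
    then obtain x where x: "x \<in> W" "y = f x" by auto
    then have "f x = f (inv_into W g (g x))"
      by (intro assms(2)) (auto simp: inv_into_into f_inv_into_f)
    then show "y \<in> (\<lambda>v. f (inv_into W g v)) ` (g ` W)" using x by auto
  qed
  then show "finite (f ` W)" "card (f ` W) \<le> card (g ` W)"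
    using surj_card_le[OF assms(1)] assms(1) finite_surj by blast+
qed

lemma card_nat_interval_le:
  fixes c :: real
  assumes "0 \<le> m"
  shows "finite {k::nat. c \<le> k \<and> k \<le> c + real m}" "card {k::nat. c \<le> k \<and> k \<le> c + real m} \<le> Suc m"
proof -
  let ?A = "{k::nat. c \<le> k \<and> k \<le> c + real m}"
  have sub: "int ` ?A \<subseteq> {\<lceil>c\<rceil>..\<lceil>c\<rceil> + int m}"
    by (auto simp: ceiling_le_iff) linarith
  have fin: "finite (int ` ?A)" using finite_subset[OF sub] by simp
  then show "finite ?A" by (rule finite_imageD) (auto intro: inj_onI)
  have "card ?A = card (int ` ?A)" by (simp add: card_image inj_on_def)
  also have "\<dots> \<le> card {\<lceil>c\<rceil>..\<lceil>c\<rceil> + int m}" by (rule card_mono[OF _ sub]) simp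
  finally show "card ?A \<le> Suc m" by simp
qed

lemma covering_number_le:
  "finite A \<Longrightarrow> E \<subseteq> (\<Union>a\<in>A. cball a r) \<Longrightarrow> covering_number E r \<le> card A"
  unfolding covering_number_def by (rule Least_le) auto

text \<open>\<open>LEAST\<close> is meaningful only once some finite cover exists, which
  \<open>B\<close> provides.\<close>

lemma covering_number_attained:
  assumes "finite B" "E \<subseteq> (\<Union>a\<in>B. cball a r)"
  obtains A where "finite A" "card A = covering_number E r" "E \<subseteq> (\<Union>a\<in>A. cball a r)"
proof -
  have "\<exists>A. finite A \<and> card A = covering_number E r \<and> E \<subseteq> (\<Union>a\<in>A. cball a r)"
    unfolding covering_number_def by (rule LeastI) (use assms in auto)
  then show ?thesis using that by blast
qed

section \<open>Covering numbers compared with numbers of codes\<close>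

context digit_system
begin

text \<open>Both points lie in one cell in every direction; bounding the Euclidean norm by the sum
  of the coordinates costs the factor \<open>CARD('d)\<close>.\<close>

lemma coding_map_dist_le:
  assumes "\<omega> \<in> words D" "\<eta> \<in> words D" "agree L \<omega> \<eta>"
    and "\<And>q. 1 / real (n q) ^ L q \<le> r / CARD('d)"
  shows "dist (coding_map n \<omega>) (coding_map n \<eta>) \<le> r"
proof -
  have "\<bar>coding_map n \<omega> $ q - coding_map n \<eta> $ q\<bar> \<le> r / CARD('d)" for q
  proof -
    have "prefix_num (n q) (\<lambda>k. \<omega> k q) (L q) = prefix_num (n q) (\<lambda>k. \<eta> k q) (L q)"
      using assms(3) by (intro prefix_num_cong) (auto simp: agree_def)
    then have "\<bar>coding_map n \<omega> $ q - coding_map n \<eta> $ q\<bar> \<le> 1 / real (n q) ^ L q"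
      using coding_map_bounds[OF assms(1), of q "L q"] coding_map_bounds[OF assms(2), of q "L q"]
      by (simp add: add_divide_distrib abs_le_iff)
    then show ?thesis using assms(4)[of q] by linarith
  qed
  then have "(\<Sum>q\<in>UNIV. \<bar>(coding_map n \<omega> - coding_map n \<eta>) $ q\<bar>) \<le> (\<Sum>q\<in>(UNIV::'d set). r / CARD('d))"
    by (intro sum_mono) simp
  then show ?thesis
    using norm_le_l1_cart[of "coding_map n \<omega> - coding_map n \<eta>"] by (simp add: dist_norm)
qed

text \<open>In each direction a ball no larger than the cells meets at most four of them, and the
  prefix numbers of the cells determine the code. At level 0 there is a single cell whatever
  \<open>r\<close> is, which admits large radii.\<close>

lemma card_codes_cball_le:
  assumes "\<And>q. L q = 0 \<or> r \<le> 1 / real (n q) ^ L q"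
  shows "finite (code L ` {\<eta> \<in> words D. coding_map n \<eta> \<in> cball a r})" (is "finite (code L ` ?W)")
    and "card (code L ` {\<eta> \<in> words D. coding_map n \<eta> \<in> cball a r}) \<le> 4 ^ CARD('d)"
proof -
  define p where "p \<eta> = (\<lambda>q. prefix_num (n q) (\<lambda>k. \<eta> k q) (L q))" for \<eta> :: "nat \<Rightarrow> 'd \<Rightarrow> nat"
  define A where "A q = (if L q = 0 then {0} else
    {k::nat. real (n q) ^ L q * a $ q - 2 \<le> k \<and> k \<le> real (n q) ^ L q * a $ q - 2 + real 3})" for q
  have A: "finite (A q)" "card (A q) \<le> 4" for q
    using card_nat_interval_le[of 3 "real (n q) ^ L q * a $ q - 2"] by (auto simp: A_def)
  have sub: "p ` ?W \<subseteq> PiE UNIV A"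
  proof
    fix v assume "v \<in> p ` ?W"
    then obtain \<eta> where \<eta>: "\<eta> \<in> words D" "dist a (coding_map n \<eta>) \<le> r" "v = p \<eta>" by auto
    have "p \<eta> q \<in> A q" for q
    proof (cases "L q = 0")
      case False
      let ?N = "real (n q) ^ L q" and ?x = "coding_map n \<eta> $ q"
      have N: "0 < ?N" using n_pos by simp
      have r: "r * ?N \<le> 1" using False assms[of q] N by (auto simp: field_simps)
      have "\<bar>a $ q - ?x\<bar> \<le> r"
        using component_le_norm_cart[of "a - coding_map n \<eta>" q] \<eta>(2) by (simp add: dist_norm)
      then have "\<bar>a $ q - ?x\<bar> * ?N \<le> r * ?N" using N by (intro mult_right_mono) auto
      also note r
      finally have "\<bar>a $ q * ?N - ?x * ?N\<bar> \<le> 1"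
        by (simp add: abs_mult left_diff_distrib[symmetric])
      moreover have "real (p \<eta> q) \<le> ?x * ?N" "?x * ?N \<le> real (p \<eta> q) + 1"
        using coding_map_bounds[OF \<eta>(1), of q "L q"] N by (auto simp: p_def field_simps)
      ultimately show ?thesis using False by (auto simp: A_def mult.commute)
    qed (simp add: A_def p_def)
    then show "v \<in> PiE UNIV A" using \<eta>(3) by auto
  qed
  have fin: "finite (PiE UNIV A)" using A by (intro finite_PiE) auto
  have inj: "code L \<omega> = code L \<eta>" if "\<omega> \<in> ?W" "\<eta> \<in> ?W" "p \<omega> = p \<eta>" for \<omega> \<eta>
  proof -
    have "\<omega> k q = \<eta> k q" if "k < L q" for k q
      using prefix_num_eqD[OF fun_cong[OF \<open>p \<omega> = p \<eta>\<close>[unfolded p_def], of q] _ _ that]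
        \<open>\<omega> \<in> ?W\<close> \<open>\<eta> \<in> ?W\<close> words_less by auto
    then show ?thesis by (simp add: code_eq_iff agree_def)
  qed
  note le = card_image_le_image[where f = "code L", OF finite_subset[OF sub fin] inj]
  show "finite (code L ` ?W)" using le(1) by blast
  have "card (code L ` ?W) \<le> card (p ` ?W)" using le(2) by blast
  also have "\<dots> \<le> card (PiE UNIV A)" by (rule card_mono[OF fin sub])
  also have "\<dots> \<le> (\<Prod>q\<in>(UNIV::'d set). 4)" using A by (simp add: card_PiE prod_mono del: prod_constant)
  finally show "card (code L ` ?W) \<le> 4 ^ CARD('d)" by simp
qed

lemma finite_codes: "finite (code L ` words D)"
proof (rule finite_subset)
  show "code L ` words D \<subseteq> PiE {..<Max (range L)} (\<lambda>k. (\<lambda>j. restrict j {q. k < L q}) ` D)"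
    by (auto simp: code_def words_def)
qed (auto intro!: finite_PiE finite_D)

text \<open>One representative word per code supplies the centres.\<close>

lemma finite_cover_codes:
  assumes "W \<subseteq> words D" "\<And>q. 1 / real (n q) ^ L q \<le> r / CARD('d)"
  obtains A where "finite A" "card A \<le> card (code L ` W)" "coding_map n ` W \<subseteq> (\<Union>a\<in>A. cball a r)"
proof
  let ?A = "(\<lambda>c. coding_map n (inv_into W (code L) c)) ` (code L ` W)"
  have fin: "finite (code L ` W)"
    using finite_subset[OF image_mono[OF assms(1)] finite_codes] .
  then show "finite ?A" "card ?A \<le> card (code L ` W)" by (auto intro: card_image_le)
  show "coding_map n ` W \<subseteq> (\<Union>a\<in>?A. cball a r)"
  proof
    fix x assume "x \<in> coding_map n ` W"
    then obtain \<omega> where \<omega>: "\<omega> \<in> W" "x = coding_map n \<omega>" by auto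
    let ?\<eta> = "inv_into W (code L) (code L \<omega>)"
    have "?\<eta> \<in> W" "code L ?\<eta> = code L \<omega>"
      using \<omega> by (auto intro: inv_into_into simp: f_inv_into_f)
    then have "dist (coding_map n ?\<eta>) x \<le> r"
      unfolding \<omega>(2) using \<omega>(1) assms by (intro coding_map_dist_le[of _ _ L]) (auto simp: code_eq_iff)
    then show "x \<in> (\<Union>a\<in>?A. cball a r)" using \<omega> by auto
  qed
qed

lemma exists_level: "0 < r \<Longrightarrow> \<exists>l. 1 / real (n q) ^ l \<le> r"
  using real_arch_pow_inv[of r "1 / n q"] n_gt_1[of q]
  by (auto simp: power_one_over intro: less_imp_le)

lemma covering_number_le_codes:
  assumes "W \<subseteq> words D" "E \<subseteq> coding_map n ` W" "\<And>q. 1 / real (n q) ^ L q \<le> r / CARD('d)"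
  shows "covering_number E r \<le> card (code L ` W)"
proof -
  obtain A where "finite A" "card A \<le> card (code L ` W)" "coding_map n ` W \<subseteq> (\<Union>a\<in>A. cball a r)"
    using finite_cover_codes[OF assms(1,3)] by blast
  then show ?thesis
    using order.trans[OF covering_number_le[of A E r]] order.trans[OF assms(2)] by simp
qed

text \<open>Each ball of an optimal cover accounts for at most \<open>4 ^ CARD('d)\<close>
  codes.\<close>

lemma codes_le_covering_number:
  assumes "coding_map n ` W \<subseteq> E" "W \<subseteq> words D" "E \<subseteq> sponge n D" "0 < r"
    and "\<And>q. L q = 0 \<or> r \<le> 1 / real (n q) ^ L q"
  shows "card (code L ` W) \<le> 4 ^ CARD('d) * covering_number E r"
proof -
  \<comment> \<open>The fine level \<open>L'\<close> only serves to produce some finite cover, so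
    that an optimal one exists.\<close>
  have "\<forall>q. \<exists>l. 1 / real (n q) ^ l \<le> r / CARD('d)"
    using assms(4) by (intro allI exists_level) simp
  from choice[OF this] obtain L' where L': "\<And>q. 1 / real (n q) ^ L' q \<le> r / CARD('d)" by auto
  obtain B where B: "finite B" "coding_map n ` words D \<subseteq> (\<Union>a\<in>B. cball a r)"
    by (rule finite_cover_codes[OF order.refl L'])
  have "E \<subseteq> (\<Union>a\<in>B. cball a r)"
    using B(2) assms(3) by (simp add: sponge_eq)
  then obtain A where A: "finite A" "card A = covering_number E r" "E \<subseteq> (\<Union>a\<in>A. cball a r)"
    by (rule covering_number_attained[OF B(1)])
  have fin: "finite (\<Union>a\<in>A. code L ` {\<eta> \<in> words D. coding_map n \<eta> \<in> cball a r})"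
    by (intro finite_UN_I[OF A(1)] card_codes_cball_le(1)[OF assms(5)])
  have "code L ` W \<subseteq> (\<Union>a\<in>A. code L ` {\<eta> \<in> words D. coding_map n \<eta> \<in> cball a r})"
  proof
    fix c assume "c \<in> code L ` W"
    then obtain \<eta> where \<eta>: "\<eta> \<in> W" "c = code L \<eta>" by auto
    then have "coding_map n \<eta> \<in> (\<Union>a\<in>A. cball a r)" using assms(1) A(3) by blast
    then show "c \<in> (\<Union>a\<in>A. code L ` {\<eta> \<in> words D. coding_map n \<eta> \<in> cball a r})"
      using \<eta> assms(2) by blast
  qed
  then have "card (code L ` W) \<le> card (\<Union>a\<in>A. code L ` {\<eta> \<in> words D. coding_map n \<eta> \<in> cball a r})"
    by (rule card_mono[OF fin])
  also have "\<dots> \<le> (\<Sum>a\<in>A. card (code L ` {\<eta> \<in> words D. coding_map n \<eta> \<in> cball a r}))"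
    by (rule card_UN_le[OF A(1)])
  also have "\<dots> \<le> (\<Sum>a\<in>A. 4 ^ CARD('d))"
    by (intro sum_mono card_codes_cball_le(2)[OF assms(5)])
  finally show ?thesis using A(2) by (simp add: mult.commute)
qed

end

section \<open>Extremal extension counts\<close>

definition max_ext :: "('d \<Rightarrow> nat) set \<Rightarrow> 'd set \<Rightarrow> 'd set \<Rightarrow> nat" where
  "max_ext D S T = Max (extensions D S T ` D)"

definition min_ext :: "('d \<Rightarrow> nat) set \<Rightarrow> 'd set \<Rightarrow> 'd set \<Rightarrow> nat" where
  "min_ext D S T = Min (extensions D S T ` D)"

abbreviation ext_product ::
  "('d::finite set \<Rightarrow> 'd set \<Rightarrow> nat) \<Rightarrow> ('d \<Rightarrow> nat) \<Rightarrow> ('d \<Rightarrow> nat) \<Rightarrow> nat" where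
  "ext_product e L L' \<equiv> (\<Prod>k<Max (range L'). e {q. k < L q} {q. k < L' q})"

context digit_system
begin

lemma extensions_bounds:
  assumes "i \<in> D"
  shows "extensions D S T i \<le> max_ext D S T" "min_ext D S T \<le> extensions D S T i"
    "1 \<le> extensions D S T i" "extensions D S T i \<le> card D"
proof -
  show "extensions D S T i \<le> max_ext D S T" "min_ext D S T \<le> extensions D S T i"
    using assms finite_D by (auto simp: max_ext_def min_ext_def)
  have "(\<lambda>j. restrict j T) ` {j \<in> D. \<forall>q\<in>S. j q = i q} \<noteq> {}" using assms by auto
  then show "1 \<le> extensions D S T i"
    using finite_D by (simp add: extensions_def Suc_le_eq card_gt_0_iff)
  have "extensions D S T i \<le> card {j \<in> D. \<forall>q\<in>S. j q = i q}"
    unfolding extensions_def using finite_D by (intro card_image_le) auto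
  also have "\<dots> \<le> card D" using finite_D by (intro card_mono) auto
  finally show "extensions D S T i \<le> card D" .
qed

lemma max_ext_attained: "\<exists>i\<in>D. extensions D S T i = max_ext D S T"
  using Max_in[of "extensions D S T ` D"] finite_D D_ne unfolding max_ext_def by fastforce

lemma min_ext_attained: "\<exists>i\<in>D. extensions D S T i = min_ext D S T"
  using Min_in[of "extensions D S T ` D"] finite_D D_ne unfolding min_ext_def by fastforce

lemma max_ext_ge_1: "1 \<le> max_ext D S T" and min_ext_ge_1: "1 \<le> min_ext D S T"
  using max_ext_attained[of S T] min_ext_attained[of S T] extensions_bounds(3) by metis+

text \<open>The words hitting the ball fall into at most \<open>4 ^ CARD('d)\<close> classes by
  coarse code; each lies in an \<open>L\<close>-cylinder, which is counted exactly by a product of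
  extension numbers.\<close>

lemma covering_number_cball_le:
  assumes "\<And>q. L q = 0 \<or> R \<le> 1 / real (n q) ^ L q"
    and "\<And>q. 1 / real (n q) ^ L' q \<le> r / CARD('d)"
  shows "covering_number (cball x R \<inter> sponge n D) r \<le> 4 ^ CARD('d) * ext_product (max_ext D) L L'"
proof -
  define W where "W = {\<eta> \<in> words D. coding_map n \<eta> \<in> cball x R}"
  have fin: "finite (code L ` W)" and card: "card (code L ` W) \<le> 4 ^ CARD('d)"
    unfolding W_def using card_codes_cball_le[OF assms(1)] by blast+
  have fib: "card (code L' ` {\<eta> \<in> words D. code L \<eta> = c}) \<le> ext_product (max_ext D) L L'"
    if c: "c \<in> code L ` W" for c
  proof -
    obtain \<omega> where \<omega>: "\<omega> \<in> words D" "c = code L \<omega>" using c by (auto simp: W_def)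
    then have "{\<eta> \<in> words D. code L \<eta> = c} = {\<eta> \<in> words D. agree L \<omega> \<eta>}"
      using code_eq_iff by metis
    then show ?thesis
      using card_codes_agreeing[OF \<omega>(1), of L' L] extensions_bounds(1)[OF words_in[OF \<omega>(1)]]
      by (simp add: prod_mono)
  qed
  have "covering_number (cball x R \<inter> sponge n D) r \<le> card (code L' ` W)"
    by (rule covering_number_le_codes[OF _ _ assms(2)]) (auto simp: W_def sponge_eq)
  also have "\<dots> \<le> card (\<Union>c\<in>code L ` W. code L' ` {\<eta> \<in> words D. code L \<eta> = c})"
    by (intro card_mono finite_UN_I[OF fin] finite_subset[OF image_mono finite_codes]) (auto simp: W_def)
  also have "\<dots> \<le> (\<Sum>c\<in>code L ` W. card (code L' ` {\<eta> \<in> words D. code L \<eta> = c}))"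
    by (rule card_UN_le[OF fin])
  also have "\<dots> \<le> card (code L ` W) * ext_product (max_ext D) L L'"
    using sum_mono[OF fib, of "code L ` W" "\<lambda>c. c"] by simp
  also have "\<dots> \<le> 4 ^ CARD('d) * ext_product (max_ext D) L L'"
    using card by (rule mult_right_mono) simp
  finally show ?thesis .
qed

text \<open>The whole \<open>L\<close>-cylinder of \<open>\<omega>\<close> lies within distance
  \<open>R\<close> of its point.\<close>

lemma prod_extensions_le_covering_number:
  assumes "\<omega> \<in> words D" "0 < r"
    and "\<And>q. 1 / real (n q) ^ L q \<le> R / CARD('d)"
    and "\<And>q. L' q = 0 \<or> r \<le> 1 / real (n q) ^ L' q"
  shows "(\<Prod>k<Max (range L'). extensions D {q. k < L q} {q. k < L' q} (\<omega> k))
    \<le> 4 ^ CARD('d) * covering_number (cball (coding_map n \<omega>) R \<inter> sponge n D) r"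
  unfolding card_codes_agreeing[OF assms(1), symmetric]
  by (rule codes_le_covering_number[OF _ _ _ assms(2,4)])
     (use assms(1) coding_map_dist_le[OF assms(1) _ _ assms(3)] in \<open>auto simp: sponge_eq\<close>)

lemma min_product_le_covering_number:
  assumes "x \<in> sponge n D" "0 < r"
    and "\<And>q. 1 / real (n q) ^ L q \<le> R / CARD('d)"
    and "\<And>q. L' q = 0 \<or> r \<le> 1 / real (n q) ^ L' q"
  shows "ext_product (min_ext D) L L' \<le> 4 ^ CARD('d) * covering_number (cball x R \<inter> sponge n D) r"
proof -
  obtain \<omega> where \<omega>: "\<omega> \<in> words D" "x = coding_map n \<omega>" using assms(1) by (auto simp: sponge_eq)
  have "ext_product (min_ext D) L L' \<le> (\<Prod>k<Max (range L'). extensions D {q. k < L q} {q. k < L' q} (\<omega> k))"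
    using extensions_bounds(2)[OF words_in[OF \<omega>(1)]] by (intro prod_mono) auto
  then show ?thesis
    using prod_extensions_le_covering_number[OF \<omega>(1) assms(2-4)] \<omega>(2) by simp
qed

lemma max_product_le_covering_number:
  assumes "0 < r"
    and "\<And>q. 1 / real (n q) ^ L q \<le> R / CARD('d)"
    and "\<And>q. L' q = 0 \<or> r \<le> 1 / real (n q) ^ L' q"
  shows "\<exists>x\<in>sponge n D. ext_product (max_ext D) L L'
    \<le> 4 ^ CARD('d) * covering_number (cball x R \<inter> sponge n D) r"
proof -
  have "\<forall>k. \<exists>i. i \<in> D \<and> extensions D {q. k < L q} {q. k < L' q} i = max_ext D {q. k < L q} {q. k < L' q}"
    using max_ext_attained by blast
  from choice[OF this] obtain \<omega> where \<omega>: "\<And>k. \<omega> k \<in> D"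
    "\<And>k. extensions D {q. k < L q} {q. k < L' q} (\<omega> k) = max_ext D {q. k < L q} {q. k < L' q}"
    by blast
  then have "\<omega> \<in> words D" by (simp add: words_def)
  from prod_extensions_le_covering_number[OF this assms] show ?thesis
    using \<omega>(2) \<open>\<omega> \<in> words D\<close> by (auto simp: sponge_eq)
qed

text \<open>Two prescribed increasing digits just after level \<^term>\<open>L q\<close> keep the point away from both
  ends of its cell in direction \<^term>\<open>q\<close>, so a slightly smaller ball meets no neighbouring cell.\<close>

lemma agree_if_close:
  assumes \<omega>: "\<omega> \<in> words D" and \<eta>: "\<eta> \<in> words D"
    and dist: "dist (coding_map n \<omega>) (coding_map n \<eta>) \<le> R"
    and R: "\<And>q. L q = 0 \<or> R < 1 / real (n q) ^ (L q + 2)"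
    and sep: "\<And>q. \<omega> (L q) q < \<omega> (Suc (L q)) q \<or> (\<forall>i\<in>D. \<forall>j\<in>D. i q = j q)"
  shows "agree L \<omega> \<eta>"
  unfolding agree_def
proof (intro allI impI)
  fix q k assume k: "k < L q"
  show "\<omega> k q = \<eta> k q"
  proof (cases "\<omega> (L q) q < \<omega> (Suc (L q)) q")
    \<comment> \<open>Then all digits of \<open>D\<close> coincide in direction \<open>q\<close>,
      and agreement is automatic.\<close>
    case False
    then show ?thesis using sep[of q] words_in[OF \<omega>] words_in[OF \<eta>] by blast
  next
    case True
    define P where "P \<zeta> = prefix_num (n q) (\<lambda>k. \<zeta> k q) (L q)" for \<zeta> :: "nat \<Rightarrow> 'd \<Rightarrow> nat"
    define a b where "a = \<omega> (L q) q" and "b = \<omega> (Suc (L q)) q"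
    define N where "N = real (n q) ^ L q"
    define m where "m = real (n q)"
    define x y where "x = coding_map n \<omega> $ q" and "y = coding_map n \<eta> $ q"
    have m: "2 \<le> m" and N: "0 < N" using n_ge[of q] by (auto simp: m_def N_def)
    have ab: "a < b" "b < n q" using True words_less[OF \<omega>] by (auto simp: a_def b_def)
    then have a: "real a + 2 \<le> m" and b: "1 \<le> real b" "real b + 1 \<le> m" by (auto simp: m_def)
    have x: "m * (m * P \<omega> + a) + b \<le> x * (N * m\<^sup>2)" "x * (N * m\<^sup>2) \<le> m * (m * P \<omega> + a) + b + 1"
      using coding_map_bounds[OF \<omega>, of q "L q + 2"] N m
      by (auto simp: P_def a_def b_def N_def m_def x_def field_simps power2_eq_square)
    have y: "P \<eta> \<le> y * N" "y * N \<le> P \<eta> + 1"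
      using coding_map_bounds[OF \<eta>, of q "L q"] N by (auto simp: P_def N_def y_def field_simps)
    have "\<bar>x - y\<bar> \<le> R"
      using component_le_norm_cart[of "coding_map n \<omega> - coding_map n \<eta>" q] dist
      by (simp add: dist_norm x_def y_def)
    also have "R < 1 / (N * m\<^sup>2)" using R[of q] k by (simp add: N_def m_def power2_eq_square mult_ac)
    finally have "\<bar>x - y\<bar> * (N * m\<^sup>2) < 1" using N m by (simp add: field_simps)
    then have xy: "\<bar>x * (N * m\<^sup>2) - y * (N * m\<^sup>2)\<bar> < 1"
      using N by (simp add: left_diff_distrib[symmetric] abs_mult)
    \<comment> \<open>In units of \<open>1 / (N * m\<^sup>2)\<close>, the point is at least 1 above
      the left end of its cell because \<open>b \<ge> 1\<close>, and at least 1 below the right end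
      because \<open>a \<le> m - 2\<close>; the distance of the points is below 1.\<close>
    have "m * (real a + 2) \<le> m * m" using a m by (intro mult_left_mono) auto
    then have up: "m * a + b + 1 \<le> m\<^sup>2 - 1" using b m by (simp add: power2_eq_square algebra_simps)
    have "0 \<le> m * a" using m by simp
    have "m * (m * P \<omega> + a) = P \<omega> * m\<^sup>2 + m * a" "(P \<omega> + 1) * m\<^sup>2 = P \<omega> * m\<^sup>2 + m\<^sup>2"
      "y * N * m\<^sup>2 = y * (N * m\<^sup>2)"
      by (simp_all add: algebra_simps power2_eq_square)
    then have "P \<omega> * m\<^sup>2 < y * N * m\<^sup>2" "y * N * m\<^sup>2 < (P \<omega> + 1) * m\<^sup>2"
      using x xy up b(1) \<open>0 \<le> m * a\<close> by linarith+
    then have "P \<omega> < y * N" "y * N < P \<omega> + 1" using m by auto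
    then have "P \<omega> = P \<eta>" using y by linarith
    then show ?thesis
      using prefix_num_eqD[of "n q" "\<lambda>k. \<omega> k q" "L q" "\<lambda>k. \<eta> k q" k] words_less[OF \<omega>] words_less[OF \<eta>] k
      by (simp add: P_def)
  qed
qed

text \<open>The word is extremal except at the positions \<open>L q\<close> and
  \<open>Suc (L q)\<close>; \<open>inj\<close> and \<open>disj\<close> prevent prescriptions for
  different coordinates from colliding. Each of these at most \<open>2 * CARD('d)\<close> positions
  costs a factor at most \<open>card D\<close>.\<close>

lemma covering_number_le_min_product:
  assumes "\<And>q. L q = 0 \<or> R < 1 / real (n q) ^ (L q + 2)"
    and "\<And>q. 1 / real (n q) ^ L' q \<le> r / CARD('d)"
    and inj: "inj L" and disj: "range L \<inter> range (\<lambda>q. Suc (L q)) = {}"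
  shows "\<exists>x\<in>sponge n D. covering_number (cball x R \<inter> sponge n D) r
    \<le> card D ^ (2 * CARD('d)) * ext_product (min_ext D) L L'"
proof -
  \<comment> \<open>A coordinate that is constant on \<open>D\<close> admits no increasing pair and
    needs none.\<close>
  have "\<exists>i j. i \<in> D \<and> j \<in> D \<and> (i q < j q \<or> (\<forall>i\<in>D. \<forall>j\<in>D. i q = j q))" for q
  proof (cases "\<forall>i\<in>D. \<forall>j\<in>D. i q = j q")
    case False
    then obtain i j where "i \<in> D" "j \<in> D" "i q \<noteq> j q" by blast
    then show ?thesis by (meson linorder_neqE_nat)
  qed (use D_ne in auto)
  then obtain d1 d2 where d: "\<And>q. d1 q \<in> D" "\<And>q. d2 q \<in> D"
    "\<And>q. d1 q q < d2 q q \<or> (\<forall>i\<in>D. \<forall>j\<in>D. i q = j q)" by metis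
  have "\<forall>k. \<exists>i. i \<in> D \<and> extensions D {q. k < L q} {q. k < L' q} i = min_ext D {q. k < L q} {q. k < L' q}"
    using min_ext_attained by blast
  from choice[OF this] obtain \<omega>0 where \<omega>0: "\<And>k. \<omega>0 k \<in> D"
    "\<And>k. extensions D {q. k < L q} {q. k < L' q} (\<omega>0 k) = min_ext D {q. k < L q} {q. k < L' q}"
    by blast
  define X where "X = range L \<union> range (\<lambda>q. Suc (L q))"
  define \<omega> where "\<omega> k = (if k \<in> range L then d1 (inv L k)
    else if k \<in> range (\<lambda>q. Suc (L q)) then d2 (inv L (k - 1)) else \<omega>0 k)" for k
  have \<omega>: "\<omega> \<in> words D" using d \<omega>0 by (auto simp: words_def \<omega>_def)
  have \<omega>12: "\<omega> (L q) = d1 q" "\<omega> (Suc (L q)) = d2 q" for q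
  proof -
    show "\<omega> (L q) = d1 q" using inj by (simp add: \<omega>_def)
    have "Suc (L q) \<notin> range L" using disj by blast
    then show "\<omega> (Suc (L q)) = d2 q" using inj by (auto simp: \<omega>_def)
  qed
  have X: "finite X" "card X \<le> 2 * CARD('d)"
  proof -
    show "finite X" by (simp add: X_def)
    have "card X \<le> card (range L) + card (range (\<lambda>q. Suc (L q)))" unfolding X_def by (rule card_Un_le)
    also have "\<dots> \<le> CARD('d) + CARD('d)" by (intro add_mono card_image_le) auto
    finally show "card X \<le> 2 * CARD('d)" by simp
  qed
  have D1: "1 \<le> card D" using finite_D D_ne by (simp add: Suc_le_eq card_gt_0_iff)
  let ?E = "\<lambda>k. extensions D {q. k < L q} {q. k < L' q}"
  let ?m = "\<lambda>k. min_ext D {q. k < L q} {q. k < L' q}"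
  have "(\<Prod>k<Max (range L'). ?E k (\<omega> k))
      \<le> (\<Prod>k<Max (range L'). (if k \<in> X then card D else 1) * ?m k)"
  proof (intro prod_mono conjI)
    fix k
    show "?E k (\<omega> k) \<le> (if k \<in> X then card D else 1) * ?m k"
    proof (cases "k \<in> X")
      case True
      \<comment> \<open>As \<open>min_ext\<close> is at least 1, it can be kept as a factor even at
        a prescribed position.\<close>
      have "?E k (\<omega> k) * 1 \<le> card D * ?m k"
        using extensions_bounds(4)[OF words_in[OF \<omega>]] min_ext_ge_1 by (intro mult_le_mono) auto
      then show ?thesis using True by simp
    next
      case False
      then have "\<omega> k = \<omega>0 k" by (auto simp: X_def \<omega>_def)
      then show ?thesis using False \<omega>0(2)[of k] by simp
    qed
  qed simp
  also have "\<dots> = card D ^ card ({..<Max (range L')} \<inter> X) * ext_product (min_ext D) L L'"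
    by (simp add: prod.distrib prod.If_cases)
  also have "\<dots> \<le> card D ^ (2 * CARD('d)) * ext_product (min_ext D) L L'"
    using X D1 card_mono[of X "{..<Max (range L')} \<inter> X"]
    by (intro mult_right_mono power_increasing) auto
  finally have prod: "(\<Prod>k<Max (range L'). ?E k (\<omega> k))
      \<le> card D ^ (2 * CARD('d)) * ext_product (min_ext D) L L'" .
  have "covering_number (cball (coding_map n \<omega>) R \<inter> sponge n D) r
      \<le> card (code L' ` {\<eta> \<in> words D. agree L \<omega> \<eta>})"
  proof (rule covering_number_le_codes[OF _ _ assms(2)])
    show "cball (coding_map n \<omega>) R \<inter> sponge n D \<subseteq> coding_map n ` {\<eta> \<in> words D. agree L \<omega> \<eta>}"
    proof
      fix y assume "y \<in> cball (coding_map n \<omega>) R \<inter> sponge n D"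
      then obtain \<eta> where \<eta>: "\<eta> \<in> words D" "dist (coding_map n \<omega>) (coding_map n \<eta>) \<le> R" "y = coding_map n \<eta>"
        by (auto simp: sponge_eq)
      have "agree L \<omega> \<eta>"
        by (rule agree_if_close[OF \<omega> \<eta>(1,2) assms(1)]) (use d \<omega>12 in auto)
      then show "y \<in> coding_map n ` {\<eta> \<in> words D. agree L \<omega> \<eta>}" using \<eta> by blast
    qed
  qed auto
  also have "\<dots> \<le> card D ^ (2 * CARD('d)) * ext_product (min_ext D) L L'"
    using prod by (simp add: card_codes_agreeing[OF \<omega>])
  finally show ?thesis using \<omega> by (auto simp: sponge_eq)
qed

end

section \<open>Releasing coordinates in stages\<close>

lemma card_image_eq_image:
  assumes "finite W" "\<And>x y. x \<in> W \<Longrightarrow> y \<in> W \<Longrightarrow> f x = f y \<longleftrightarrow> g x = g y"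
  shows "card (f ` W) = card (g ` W)"
  using card_image_le_image(2)[of f W g] card_image_le_image(2)[of g W f] assms
  by (metis finite_imageI le_antisym)

lemma card_image_fibres:
  assumes "finite W" "\<And>x y. x \<in> W \<Longrightarrow> y \<in> W \<Longrightarrow> f x = f y \<Longrightarrow> g x = g y"
  shows "card (f ` W) = (\<Sum>c\<in>g ` W. card (f ` {x \<in> W. g x = c}))"
proof -
  have "f ` W = (\<Union>c\<in>g ` W. f ` {x \<in> W. g x = c})" by auto
  moreover have "card (\<Union>c\<in>g ` W. f ` {x \<in> W. g x = c}) = (\<Sum>c\<in>g ` W. card (f ` {x \<in> W. g x = c}))"
  proof (rule card_UN_disjoint)
    show "\<forall>c\<in>g ` W. \<forall>d\<in>g ` W. c \<noteq> d \<longrightarrow> f ` {x \<in> W. g x = c} \<inter> f ` {x \<in> W. g x = d} = {}"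
      using assms(2) by blast
  qed (use assms(1) in auto)
  ultimately show ?thesis by simp
qed

lemma restrict_eq_iff: "restrict f S = restrict g S \<longleftrightarrow> (\<forall>q\<in>S. f q = g q)"
  by (metis restrict_apply restrict_ext)

context digit_system
begin

text \<open>Sort the extensions from \<open>S\<close> to \<open>U\<close> by their restriction to
  \<open>T\<close>: there are \<open>extensions D S T i\<close> classes, and each has the size of an
  extension count from \<open>T\<close> to \<open>U\<close> for some digit of
  \<open>D\<close>.\<close>

lemma extensions_mult:
  assumes "i \<in> D" "S \<subseteq> T" "T \<subseteq> U"
  shows "extensions D S U i \<le> extensions D S T i * max_ext D T U"
    and "extensions D S T i * min_ext D T U \<le> extensions D S U i"
proof -
  define W where "W = {j \<in> D. \<forall>q\<in>S. j q = i q}"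
  have eq: "extensions D S U i =
      (\<Sum>c\<in>(\<lambda>j. restrict j T) ` W. card ((\<lambda>j. restrict j U) ` {j \<in> W. restrict j T = c}))"
    unfolding extensions_def W_def[symmetric] using finite_D assms(3)
    by (intro card_image_fibres) (auto simp: W_def restrict_eq_iff)
  have fib: "card ((\<lambda>j. restrict j U) ` {j \<in> W. restrict j T = c}) \<in> extensions D T U ` D"
    if c: "c \<in> (\<lambda>j. restrict j T) ` W" for c
  proof -
    obtain j where j: "j \<in> W" "c = restrict j T" using c by auto
    then have "{k \<in> W. restrict k T = c} = {k \<in> D. \<forall>q\<in>T. k q = j q}"
      using assms(2) by (auto simp: W_def restrict_eq_iff)
    then show ?thesis using j(1) by (auto simp: extensions_def W_def)
  qed
  have bounds: "min_ext D T U \<le> card ((\<lambda>j. restrict j U) ` {j \<in> W. restrict j T = c})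
      \<and> card ((\<lambda>j. restrict j U) ` {j \<in> W. restrict j T = c}) \<le> max_ext D T U"
    if "c \<in> (\<lambda>j. restrict j T) ` W" for c
    using fib[OF that] extensions_bounds(1,2)[of _ T U] by auto
  have card: "card ((\<lambda>j. restrict j T) ` W) = extensions D S T i"
    by (simp add: extensions_def W_def)
  show "extensions D S U i \<le> extensions D S T i * max_ext D T U"
    using sum_bounded_above[of "(\<lambda>j. restrict j T) ` W" _ "max_ext D T U"] bounds
    by (simp only: eq card of_nat_id)
  show "extensions D S T i * min_ext D T U \<le> extensions D S U i"
    using sum_bounded_below[of "(\<lambda>j. restrict j T) ` W" "min_ext D T U"] bounds
    by (simp only: eq card of_nat_id)
qed

text \<open>The maxima of the two stages may belong to incompatible digits, hence only an
  inequality. It is the source of the upper bound for the Assouad dimension.\<close>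

lemma max_ext_mult:
  assumes "S \<subseteq> T" "T \<subseteq> U"
  shows "max_ext D S U \<le> max_ext D S T * max_ext D T U"
proof -
  obtain i where i: "i \<in> D" "extensions D S U i = max_ext D S U" using max_ext_attained by blast
  then show ?thesis
    using extensions_mult(1)[OF i(1) assms] extensions_bounds(1)[OF i(1), of S T]
    by (metis mult_le_mono1 order.trans)
qed

lemma min_ext_mult:
  assumes "S \<subseteq> T" "T \<subseteq> U"
  shows "min_ext D S T * min_ext D T U \<le> min_ext D S U"
proof -
  obtain i where i: "i \<in> D" "extensions D S U i = min_ext D S U" using min_ext_attained by blast
  then show ?thesis
    using extensions_mult(2)[OF i(1) assms] extensions_bounds(2)[OF i(1), of S T]
    by (metis mult_le_mono1 order.trans)
qed

lemma extensions_subset: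
  assumes "i \<in> D" "T \<subseteq> S"
  shows "extensions D S T i = 1"
proof -
  have "(\<lambda>j. restrict j T) ` {j \<in> D. \<forall>q\<in>S. j q = i q} = {restrict i T}"
    using assms by (auto simp: restrict_eq_iff subset_iff intro!: image_eqI[of _ _ i])
  then show ?thesis by (simp add: extensions_def)
qed

lemma max_ext_subset: "T \<subseteq> S \<Longrightarrow> max_ext D S T = 1"
  and min_ext_subset: "T \<subseteq> S \<Longrightarrow> min_ext D S T = 1"
  using max_ext_attained[of S T] min_ext_attained[of S T] extensions_subset by metis+

section \<open>Levels of a scale\<close>

text \<open>Rounding down gives cells of side at least \<open>u\<close>, suited to counting the
  cells that a ball meets; rounding up gives cells of side at most \<open>u\<close>, suited to
  covering. For \<open>u > 1\<close> both levels are cut off at 0 and the cells have side 1.\<close>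

definition low_level :: "real \<Rightarrow> 'd \<Rightarrow> nat" where
  "low_level u q = nat \<lfloor>ln (1 / u) / ln (n q)\<rfloor>"

definition high_level :: "real \<Rightarrow> 'd \<Rightarrow> nat" where
  "high_level u q = nat \<lceil>ln (1 / u) / ln (n q)\<rceil>"

lemma low_level:
  assumes "0 < u" shows "low_level u q = 0 \<or> u \<le> 1 / real (n q) ^ low_level u q"
proof (cases "low_level u q = 0")
  case False
  then have "real (low_level u q) \<le> ln (1 / u) / ln (n q)"
    by (simp add: low_level_def)
  then have "ln (real (n q) ^ low_level u q) \<le> ln (1 / u)"
    using ln_n_pos[of q] n_pos[of q] by (simp add: ln_realpow field_simps)
  then have "real (n q) ^ low_level u q \<le> 1 / u"
    using assms n_pos[of q] by (subst (asm) ln_le_cancel_iff) auto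
  then show ?thesis using assms n_pos[of q] by (simp add: field_simps)
qed simp

lemma high_level:
  assumes "0 < u" shows "1 / real (n q) ^ high_level u q \<le> u"
proof -
  have "ln (1 / u) / ln (n q) \<le> real (high_level u q)"
    unfolding high_level_def by linarith
  then have "ln (1 / u) \<le> ln (real (n q) ^ high_level u q)"
    using ln_n_pos[of q] n_pos[of q] by (simp add: ln_realpow field_simps)
  then have "1 / u \<le> real (n q) ^ high_level u q"
    using assms n_pos[of q] by (subst (asm) ln_le_cancel_iff) auto
  then show ?thesis using assms n_pos[of q] by (simp add: field_simps)
qed

lemma level_antimono:
  assumes "n q \<le> n q'"
  shows "low_level u q' \<le> low_level u q" "high_level u q' \<le> high_level u q"
proof -
  have "max 0 (ln (1 / u)) / ln (n q') \<le> max 0 (ln (1 / u)) / ln (n q)"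
    using assms ln_n_pos n_pos[of q] by (intro divide_left_mono) auto
  moreover have "0 < ln (n q)" "0 < ln (n q')" by (rule ln_n_pos)+
  \<comment> \<open>For \<open>u > 1\<close> the numerator is negative and the comparison reverses,
    but both levels are then 0.\<close>
  ultimately have le: "ln (1 / u) / ln (n q') \<le> ln (1 / u) / ln (n q)
    \<or> ln (1 / u) / ln (n q') \<le> 0"
    by (auto simp: max_def divide_le_0_iff split: if_splits)
  have mono: "nat \<lfloor>x\<rfloor> \<le> nat \<lfloor>y\<rfloor> \<and> nat \<lceil>x\<rceil> \<le> nat \<lceil>y\<rceil>" if "x \<le> y \<or> x \<le> 0" for x y :: real
    using that
  proof
    assume "x \<le> 0"
    then have "\<lfloor>x\<rfloor> \<le> 0" "\<lceil>x\<rceil> \<le> 0" by (simp_all add: floor_le_iff ceiling_le_iff)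
    then show ?thesis by simp
  qed (intro conjI nat_mono floor_mono ceiling_mono)
  show "low_level u q' \<le> low_level u q" "high_level u q' \<le> high_level u q"
    unfolding low_level_def high_level_def using mono[OF le] by blast+
qed

end

section \<open>Growth of extension products\<close>

text \<open>An interval length with two competing ends on either side; where fewer compete, an
  argument is repeated, so that all terms of \<open>growth\<close> have one form.\<close>

definition overlap :: "real \<Rightarrow> real \<Rightarrow> real \<Rightarrow> real \<Rightarrow> real" where
  "overlap p q u v = max 0 (min p q - max u v)"

text \<open>For decreasing level vectors \<open>a\<close> and \<open>b\<close>, each \<open>overlap\<close> is the number of positions at which
  \<open>a\<close> determines the coordinates in the first and \<open>b\<close> those in the second argument of \<open>w\<close>.\<close>

definition growth :: "(3 set \<Rightarrow> 3 set \<Rightarrow> real) \<Rightarrow> (3 \<Rightarrow> real) \<Rightarrow> (3 \<Rightarrow> real) \<Rightarrow> real" where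
  "growth w a b =
     w {1, 2} UNIV * overlap (a 2) (b 3) (a 3) (a 3)
   + w {1} UNIV * overlap (a 1) (b 3) (a 2) (a 2)
   + w {} UNIV * overlap (b 3) (b 3) (a 1) (a 1)
   + w {1} {1, 2} * overlap (a 1) (b 2) (a 2) (b 3)
   + w {} {1, 2} * overlap (b 2) (b 2) (a 1) (b 3)
   + w {} {1} * overlap (b 1) (b 1) (a 1) (b 2)"

definition total_weight :: "(3 set \<Rightarrow> 3 set \<Rightarrow> real) \<Rightarrow> real" where
  "total_weight w = w {1, 2} UNIV + w {1} UNIV + w {} UNIV + w {1} {1, 2} + w {} {1, 2} + w {} {1}"

lemma overlap_nonneg: "0 \<le> overlap p q u v"
  by (simp add: overlap_def)

lemma overlap_scale: "0 \<le> t \<Longrightarrow> overlap (t * p) (t * q) (t * u) (t * v) = t * overlap p q u v"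
  by (simp add: overlap_def max_mult_distrib_left min_mult_distrib_left right_diff_distrib)

text \<open>Either end of the interval moves by at most \<open>c\<close>, and truncation at 0 is
  1-Lipschitz.\<close>

lemma overlap_diff_le:
  assumes "\<bar>p - p'\<bar> \<le> c" "\<bar>q - q'\<bar> \<le> c" "\<bar>u - u'\<bar> \<le> c" "\<bar>v - v'\<bar> \<le> c"
  shows "\<bar>overlap p q u v - overlap p' q' u' v'\<bar> \<le> 2 * c"
proof -
  define A A' B B' where "A = min p q" and "A' = min p' q'" and "B = max u v" and "B' = max u' v'"
  have "\<bar>A - A'\<bar> \<le> c" using assms(1,2) by (auto simp: A_def A'_def min_def abs_le_iff)
  moreover have "\<bar>B - B'\<bar> \<le> c" using assms(3,4) by (auto simp: B_def B'_def max_def abs_le_iff)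
  ultimately have "\<bar>A - B - (A' - B')\<bar> \<le> 2 * c" by linarith
  moreover have "\<bar>max 0 x - max 0 y\<bar> \<le> \<bar>x - y\<bar>" for x y :: real
    by (cases "0 \<le> x"; cases "0 \<le> y") auto
  ultimately have "\<bar>max 0 (A - B) - max 0 (A' - B')\<bar> \<le> 2 * c" by (meson order.trans)
  then show ?thesis by (simp add: overlap_def A_def A'_def B_def B'_def)
qed

lemma growth_scale: "0 \<le> t \<Longrightarrow> growth w (\<lambda>q. t * a q) (\<lambda>q. t * b q) = t * growth w a b"
  by (simp add: growth_def overlap_scale algebra_simps)

text \<open>Makes rounding harmless: bounded errors in the levels become a bounded factor after
  exponentiation.\<close>

lemma growth_diff_le:
  assumes w: "\<And>S T. 0 \<le> w S T" and ab: "\<And>q. \<bar>a q - a' q\<bar> \<le> c" "\<And>q. \<bar>b q - b' q\<bar> \<le> c"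
  shows "\<bar>growth w a b - growth w a' b'\<bar> \<le> 2 * c * total_weight w"
proof -
  have scale: "\<bar>w S T * x - w S T * y\<bar> \<le> w S T * (2 * c)" if "\<bar>x - y\<bar> \<le> 2 * c" for S T x y
  proof -
    have "\<bar>w S T * x - w S T * y\<bar> = w S T * \<bar>x - y\<bar>"
      using w[of S T] abs_mult[of "w S T" "x - y"] by (simp only: right_diff_distrib abs_of_nonneg)
    then show ?thesis using mult_left_mono[OF that w] by simp
  qed
  have add: "\<bar>x + y - (x' + y')\<bar> \<le> e + e'" if "\<bar>x - x'\<bar> \<le> e" "\<bar>y - y'\<bar> \<le> e'" for x y x' y' e e' :: real
    using that by linarith
  have "2 * c * total_weight w = w {1, 2} UNIV * (2 * c) + w {1} UNIV * (2 * c) + w {} UNIV * (2 * c)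
      + w {1} {1, 2} * (2 * c) + w {} {1, 2} * (2 * c) + w {} {1} * (2 * c)"
    by (simp add: total_weight_def algebra_simps)
  then show ?thesis
    unfolding growth_def by (simp only:) (intro add scale overlap_diff_le ab)
qed

lemma sum_overlap:
  assumes "q \<le> K"
  shows "(\<Sum>k<K. c * of_bool (k < p \<and> k < q \<and> u \<le> k \<and> v \<le> k)) = c * overlap (real p) (real q) (real u) (real v)"
proof -
  have "(\<Sum>k<K. c * of_bool (k < p \<and> k < q \<and> u \<le> k \<and> v \<le> k)) =
      c * (\<Sum>k<K. of_bool (k < p \<and> k < q \<and> u \<le> k \<and> v \<le> k))"
    by (simp add: sum_distrib_left)
  also have "(\<Sum>k<K. of_bool (k < p \<and> k < q \<and> u \<le> k \<and> v \<le> k)) = real (card {max u v..<min p q})"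
    using assms by (subst sum.mono_neutral_cong_right[of "{..<K}" "{max u v..<min p q}" _ "\<lambda>_. 1"]) auto
  also have "real (card {max u v..<min p q}) = overlap (real p) (real q) (real u) (real v)"
  proof -
    have "real (a - b) = max 0 (real a - real b)" for a b :: nat
      by (cases "b \<le> a") (auto simp: of_nat_diff)
    then show ?thesis by (simp only: overlap_def card_atLeastLessThan of_nat_min of_nat_max)
  qed
  finally show ?thesis .
qed

lemma determined_coordinates:
  fixes L :: "3 \<Rightarrow> nat"
  assumes "L 3 \<le> L 2" "L 2 \<le> L 1"
  shows "{q. k < L q} = (if k < L 3 then UNIV else if k < L 2 then {1, 2} else if k < L 1 then {1} else {})"
  using assms by (auto simp: set_eq_iff forall_3)

text \<open>Decreasing levels make the determined sets initial segments of the coordinates. Only the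
  six strict inclusions between such segments can carry weight, and each occurs on an interval of
  positions.\<close>

lemma sum_weights_eq_growth:
  fixes L L' :: "3 \<Rightarrow> nat"
  assumes L: "L 3 \<le> L 2" "L 2 \<le> L 1" and L': "L' 3 \<le> L' 2" "L' 2 \<le> L' 1"
    and w: "\<And>S T. T \<subseteq> S \<Longrightarrow> w S T = 0"
  shows "(\<Sum>k<Max (range L'). w {q. k < L q} {q. k < L' q}) = growth w (\<lambda>q. real (L q)) (\<lambda>q. real (L' q))"
proof -
  let ?K = "Max (range L')"
  have K: "L' q \<le> ?K" for q by (rule level_le_Max)
  have "w {q. k < L q} {q. k < L' q} =
     w {1, 2} UNIV * of_bool (k < L 2 \<and> k < L' 3 \<and> L 3 \<le> k \<and> L 3 \<le> k)
   + w {1} UNIV * of_bool (k < L 1 \<and> k < L' 3 \<and> L 2 \<le> k \<and> L 2 \<le> k)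
   + w {} UNIV * of_bool (k < L' 3 \<and> k < L' 3 \<and> L 1 \<le> k \<and> L 1 \<le> k)
   + w {1} {1, 2} * of_bool (k < L 1 \<and> k < L' 2 \<and> L 2 \<le> k \<and> L' 3 \<le> k)
   + w {} {1, 2} * of_bool (k < L' 2 \<and> k < L' 2 \<and> L 1 \<le> k \<and> L' 3 \<le> k)
   + w {} {1} * of_bool (k < L' 1 \<and> k < L' 1 \<and> L 1 \<le> k \<and> L' 2 \<le> k)" for k
    unfolding determined_coordinates[OF L] determined_coordinates[OF L']
    using L L' by (auto simp: w)
  then show ?thesis
    by (simp only: sum.distrib sum_overlap[OF K] growth_def)
qed

text \<open>In direction \<open>q\<close> the positions from \<open>a q\<close> to
  \<open>b q\<close> are partitioned by what else is determined there; these are the partitions for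
  coordinates 3, 2 and 1.\<close>

lemma overlap_totals:
  assumes "a3 \<le> a2" "a2 \<le> a1" "b3 \<le> b2" "b2 \<le> b1" "a1 \<le> b1" "a2 \<le> b2" "a3 \<le> b3"
  shows "overlap a2 b3 a3 a3 + overlap a1 b3 a2 a2 + overlap b3 b3 a1 a1 = b3 - a3"
    and "overlap a1 b3 a2 a2 + overlap b3 b3 a1 a1 + overlap a1 b2 a2 b3 + overlap b2 b2 a1 b3 = b2 - a2"
    and "overlap b3 b3 a1 a1 + overlap b2 b2 a1 b3 + overlap b1 b1 a1 b2 = b1 - a1"
  using assms
  by (cases "b3 \<le> a2"; cases "b3 \<le> a1"; cases "b2 \<le> a1"; simp add: overlap_def max_def min_def)+

context
  fixes w :: "3 set \<Rightarrow> 3 set \<Rightarrow> real" and a b :: "3 \<Rightarrow> real"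
  assumes order: "a 3 \<le> a 2" "a 2 \<le> a 1" "b 3 \<le> b 2" "b 2 \<le> b 1" "\<And>q. a q \<le> b q"
begin

text \<open>The left side is what releasing the coordinates one by one would give. Each correction
  is a defect of additivity of \<open>w\<close>, times the length on which several coordinates are
  released together.\<close>

lemma growth_split:
  "w {} {1} * (b 1 - a 1) + w {1} {1, 2} * (b 2 - a 2) + w {1, 2} UNIV * (b 3 - a 3) =
    growth w a b
    + (w {1} {1, 2} + w {1, 2} UNIV - w {1} UNIV) * overlap (a 1) (b 3) (a 2) (a 2)
    + (w {} {1} + w {1} {1, 2} + w {1, 2} UNIV - w {} UNIV) * overlap (b 3) (b 3) (a 1) (a 1)
    + (w {} {1} + w {1} {1, 2} - w {} {1, 2}) * overlap (b 2) (b 2) (a 1) (b 3)"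
  unfolding overlap_totals[OF order order(5) order(5), symmetric] growth_def
  by (simp add: algebra_simps)

lemma growth_le_split:
  assumes "\<And>S T U. S \<subseteq> T \<Longrightarrow> T \<subseteq> U \<Longrightarrow> w S U \<le> w S T + w T U"
  shows "growth w a b \<le> w {} {1} * (b 1 - a 1) + w {1} {1, 2} * (b 2 - a 2) + w {1, 2} UNIV * (b 3 - a 3)"
proof -
  have "0 \<le> w {1} {1, 2} + w {1, 2} UNIV - w {1} UNIV" "0 \<le> w {} {1} + w {1} {1, 2} - w {} {1, 2}"
    "0 \<le> w {} {1} + w {1} {1, 2} + w {1, 2} UNIV - w {} UNIV"
    using assms[of "{1}" "{1, 2}" UNIV] assms[of "{}" "{1}" "{1, 2}"] assms[of "{}" "{1}" UNIV] by auto
  from this[THEN mult_nonneg_nonneg, OF overlap_nonneg] show ?thesis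
    unfolding growth_split by (smt (verit))
qed

lemma growth_ge_split:
  assumes "\<And>S T U. S \<subseteq> T \<Longrightarrow> T \<subseteq> U \<Longrightarrow> w S T + w T U \<le> w S U"
  shows "w {} {1} * (b 1 - a 1) + w {1} {1, 2} * (b 2 - a 2) + w {1, 2} UNIV * (b 3 - a 3) \<le> growth w a b"
proof -
  have "w {1} {1, 2} + w {1, 2} UNIV - w {1} UNIV \<le> 0" "w {} {1} + w {1} {1, 2} - w {} {1, 2} \<le> 0"
    "w {} {1} + w {1} {1, 2} + w {1, 2} UNIV - w {} UNIV \<le> 0"
    using assms[of "{1}" "{1, 2}" UNIV] assms[of "{}" "{1}" "{1, 2}"] assms[of "{}" "{1}" UNIV] by auto
  from this[THEN mult_nonpos_nonneg, OF overlap_nonneg] show ?thesis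
    unfolding growth_split by (smt (verit))
qed

end

section \<open>Counting estimates in dimension three\<close>

text \<open>Truncated like the levels, so that \<open>lam q * log_scale u\<close> approximates them
  for \<open>u > 1\<close> as well.\<close>

definition log_scale :: "real \<Rightarrow> real" where
  "log_scale u = max 0 (ln (1 / u))"

lemma nat_floor_ceiling_error:
  "\<bar>real (nat \<lfloor>x\<rfloor>) - max 0 x\<bar> \<le> 1" "\<bar>real (nat \<lceil>x\<rceil>) - max 0 x\<bar> \<le> 1" for x :: real
  by linarith+

lemma ext_product_eq_exp_growth:
  fixes L L' :: "3 \<Rightarrow> nat"
  assumes "L 3 \<le> L 2" "L 2 \<le> L 1" "L' 3 \<le> L' 2" "L' 2 \<le> L' 1"
    and e: "\<And>S T. 1 \<le> e S T" "\<And>S T. T \<subseteq> S \<Longrightarrow> e S T = 1"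
  shows "real (ext_product e L L') =
    exp (growth (\<lambda>S T. ln (real (e S T))) (\<lambda>q. real (L q)) (\<lambda>q. real (L' q)))"
proof -
  have pos: "0 < real (e S T)" for S T using e(1)[of S T] by simp
  have "real (ext_product e L L') = (\<Prod>k<Max (range L'). exp (ln (real (e {q. k < L q} {q. k < L' q}))))"
    using pos by simp
  also have "\<dots> = exp (\<Sum>k<Max (range L'). ln (real (e {q. k < L q} {q. k < L' q})))"
    by (rule exp_sum[symmetric]) simp
  also have "\<dots> = exp (growth (\<lambda>S T. ln (real (e S T))) (\<lambda>q. real (L q)) (\<lambda>q. real (L' q)))"
    using sum_weights_eq_growth[OF assms(1-4), of "\<lambda>S T. ln (real (e S T))"] e(2) by simp
  finally show ?thesis .
qed

lemma ext_product_estimate: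
  fixes L L' :: "3 \<Rightarrow> nat" and e :: "3 set \<Rightarrow> 3 set \<Rightarrow> nat"
  assumes "L 3 \<le> L 2" "L 2 \<le> L 1" "L' 3 \<le> L' 2" "L' 2 \<le> L' 1"
    and e: "\<And>S T. 1 \<le> e S T" "\<And>S T. T \<subseteq> S \<Longrightarrow> e S T = 1"
    and ab: "\<And>q. \<bar>real (L q) - a q\<bar> \<le> c" "\<And>q. \<bar>real (L' q) - b q\<bar> \<le> c"
  defines "w \<equiv> \<lambda>S T. ln (real (e S T))"
  shows "real (ext_product e L L') \<le> exp (2 * c * total_weight w) * exp (growth w a b)"
    and "exp (growth w a b) \<le> exp (2 * c * total_weight w) * real (ext_product e L L')"
proof -
  have "0 \<le> w S T" for S T using e(1)[of S T] by (simp add: w_def)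
  then have diff: "\<bar>growth w (\<lambda>q. real (L q)) (\<lambda>q. real (L' q)) - growth w a b\<bar> \<le> 2 * c * total_weight w"
    using ab by (rule growth_diff_le)
  have eq: "real (ext_product e L L') = exp (growth w (\<lambda>q. real (L q)) (\<lambda>q. real (L' q)))"
    unfolding w_def by (rule ext_product_eq_exp_growth[OF assms(1-6)])
  show "real (ext_product e L L') \<le> exp (2 * c * total_weight w) * exp (growth w a b)"
    and "exp (growth w a b) \<le> exp (2 * c * total_weight w) * real (ext_product e L L')"
    unfolding eq mult_exp_exp exp_le_cancel_iff using diff by linarith+
qed

section \<open>Scales and levels of a three-dimensional sponge\<close>

locale digit_system3 = digit_system n D for n :: "3 \<Rightarrow> nat" and D +
  assumes n_less: "n 1 < n 2" "n 2 < n 3"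
begin

text \<open>A threshold \<open>\<theta> \<le> ln (n p) / ln (n q)\<close> becomes
  \<open>\<theta> * lam p \<le> lam q\<close>: the level of \<open>R\<close> in direction
  \<open>p\<close> is at most that of \<open>R powr (1 / \<theta>)\<close> in direction
  \<open>q\<close>.\<close>

definition lam :: "3 \<Rightarrow> real" where "lam q = 1 / ln (n q)"

definition log_max :: "3 set \<Rightarrow> 3 set \<Rightarrow> real" where "log_max S T = ln (real (max_ext D S T))"

definition log_min :: "3 set \<Rightarrow> 3 set \<Rightarrow> real" where "log_min S T = ln (real (min_ext D S T))"

lemma lam_pos: "0 < lam q"
  using ln_n_pos by (simp add: lam_def)

lemma lam_less: "lam 2 < lam 1" "lam 3 < lam 2"
  using n_less ln_n_pos[of 1] ln_n_pos[of 2] n_pos[of 1] n_pos[of 2]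
  by (auto simp: lam_def intro!: divide_strict_left_mono)

lemma level_errors:
  assumes "0 < u"
  shows "\<bar>real (low_level u q) - lam q * log_scale u\<bar> \<le> 1"
    and "\<bar>real (high_level u q) - lam q * log_scale u\<bar> \<le> 1"
proof -
  have "lam q * log_scale u = max 0 (ln (1 / u) / ln (n q))"
    using lam_pos[of q] by (simp add: log_scale_def max_mult_distrib_left lam_def)
  then show "\<bar>real (low_level u q) - lam q * log_scale u\<bar> \<le> 1"
    and "\<bar>real (high_level u q) - lam q * log_scale u\<bar> \<le> 1"
    using nat_floor_ceiling_error by (simp_all only: low_level_def high_level_def)
qed

lemma log_scale_third: "0 < u \<Longrightarrow> \<bar>log_scale (u / 3) - log_scale u\<bar> \<le> ln 3"
  by (simp add: log_scale_def ln_div max_def)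

text \<open>One constant for all level choices: 1 for rounding, 3 for lowering a level by 3, and
  \<open>lam q * ln 3\<close> for passing from \<open>u\<close> to \<open>u / 3\<close>, where 3 is
  the number of coordinates.\<close>

definition level_error :: real where "level_error = 4 + (\<Sum>q\<in>UNIV. lam q) * ln 3"

lemma level_error:
  assumes "0 < u"
  shows "\<bar>real (low_level u q) - lam q * log_scale u\<bar> \<le> level_error"
    and "\<bar>real (low_level u q - 3) - lam q * log_scale u\<bar> \<le> level_error"
    and "\<bar>real (high_level (u / 3) q) - lam q * log_scale u\<bar> \<le> level_error"
proof -
  have "lam q \<le> (\<Sum>q\<in>UNIV. lam q)"
    using lam_pos by (intro member_le_sum) (auto intro: less_imp_le)
  then have le: "lam q * ln 3 \<le> (\<Sum>q\<in>UNIV. lam q) * ln 3" by (intro mult_right_mono) auto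
  have nn: "0 \<le> lam q * ln 3" using lam_pos[of q] by simp
  show 1: "\<bar>real (low_level u q) - lam q * log_scale u\<bar> \<le> level_error"
    using level_errors(1)[OF assms, of q] le nn unfolding level_error_def by linarith
  have "0 \<le> lam q * log_scale u" using lam_pos[of q] by (simp add: log_scale_def)
  moreover have "real (low_level u q) - 3 \<le> real (low_level u q - 3)" "real (low_level u q - 3) \<le> real (low_level u q)"
    by auto
  ultimately show "\<bar>real (low_level u q - 3) - lam q * log_scale u\<bar> \<le> level_error"
    using level_errors(1)[OF assms, of q] le nn unfolding level_error_def abs_le_iff by linarith
  have third: "\<bar>real (high_level (u / 3) q) - lam q * log_scale (u / 3)\<bar> \<le> 1"
    using assms by (intro level_errors) simp
  have "\<bar>lam q * (log_scale (u / 3) - log_scale u)\<bar> \<le> lam q * ln 3"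
    using mult_left_mono[OF log_scale_third[OF assms], of "lam q"] lam_pos[of q] by (simp add: abs_mult)
  then show "\<bar>real (high_level (u / 3) q) - lam q * log_scale u\<bar> \<le> level_error"
    using third le
    unfolding level_error_def right_diff_distrib abs_le_iff by linarith
qed

lemma levels_decreasing:
  "low_level u 3 \<le> low_level u 2" "low_level u 2 \<le> low_level u 1"
  "high_level u 3 \<le> high_level u 2" "high_level u 2 \<le> high_level u 1"
  using n_less by (auto intro: level_antimono)

abbreviation "scaled u \<equiv> \<lambda>q. lam q * log_scale u"

lemmas max_estimate = ext_product_estimate[where e = "max_ext D", OF _ _ _ _ max_ext_ge_1 max_ext_subset,
    folded log_max_def]
lemmas min_estimate = ext_product_estimate[where e = "min_ext D", OF _ _ _ _ min_ext_ge_1 min_ext_subset,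
    folded log_min_def]

text \<open>Coarse levels are rounded down so that the \<open>R\<close>-ball meets few cells; fine
  levels are those of \<open>r / 3\<close>, rounded up, so that cells have diameter at most
  \<open>r\<close>. The factor 64 is \<open>4 ^ 3\<close>.\<close>

lemma covering_number_upper:
  "\<exists>C>0. \<forall>x R r. 0 < R \<longrightarrow> 0 < r \<longrightarrow>
    real (covering_number (cball x R \<inter> sponge n D) r) \<le> C * exp (growth log_max (scaled R) (scaled r))"
proof (intro exI[of _ "64 * exp (2 * level_error * total_weight log_max)"] conjI allI impI)
  fix x :: "real ^ 3" and R r :: real assume R: "0 < R" and r: "0 < r"
  have "covering_number (cball x R \<inter> sponge n D) r
      \<le> 4 ^ CARD(3) * ext_product (max_ext D) (low_level R) (high_level (r / 3))"
    using low_level[OF R] high_level[of "r / 3"] r by (intro covering_number_cball_le) auto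
  then have "real (covering_number (cball x R \<inter> sponge n D) r)
      \<le> real (64 * ext_product (max_ext D) (low_level R) (high_level (r / 3)))"
    by (intro of_nat_mono) simp
  also have "\<dots> = 64 * real (ext_product (max_ext D) (low_level R) (high_level (r / 3)))" by simp
  also have "\<dots> \<le> 64 * (exp (2 * level_error * total_weight log_max) * exp (growth log_max (scaled R) (scaled r)))"
    by (intro mult_left_mono max_estimate levels_decreasing level_error R r) simp_all
  finally show "real (covering_number (cball x R \<inter> sponge n D) r)
      \<le> 64 * exp (2 * level_error * total_weight log_max) * exp (growth log_max (scaled R) (scaled r))"
    by (simp add: mult.assoc)
qed simp

text \<open>The roundings are exchanged: cylinders of scale \<open>R / 3\<close> fit into the
  \<open>R\<close>-ball, and an \<open>r\<close>-ball meets few of the fine cells.\<close>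

lemma covering_number_upper_attained:
  "\<exists>C>0. \<forall>R r. 0 < R \<longrightarrow> 0 < r \<longrightarrow> (\<exists>x\<in>sponge n D.
    exp (growth log_max (scaled R) (scaled r)) \<le> C * real (covering_number (cball x R \<inter> sponge n D) r))"
proof (intro exI[of _ "exp (2 * level_error * total_weight log_max) * 64"] conjI allI impI)
  fix R r :: real assume R: "0 < R" and r: "0 < r"
  have "\<exists>x\<in>sponge n D. ext_product (max_ext D) (high_level (R / 3)) (low_level r)
      \<le> 4 ^ CARD(3) * covering_number (cball x R \<inter> sponge n D) r"
    using low_level[OF r] high_level[of "R / 3"] R r by (intro max_product_le_covering_number) auto
  then obtain x where x: "x \<in> sponge n D" "ext_product (max_ext D) (high_level (R / 3)) (low_level r)
      \<le> 64 * covering_number (cball x R \<inter> sponge n D) r" by auto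
  have "exp (growth log_max (scaled R) (scaled r)) \<le> exp (2 * level_error * total_weight log_max)
      * real (ext_product (max_ext D) (high_level (R / 3)) (low_level r))"
    by (intro max_estimate levels_decreasing level_error R r)
  also have "\<dots> \<le> exp (2 * level_error * total_weight log_max) * real (64 * covering_number (cball x R \<inter> sponge n D) r)"
    using x(2) by (intro mult_left_mono of_nat_mono) simp_all
  finally show "\<exists>x\<in>sponge n D. exp (growth log_max (scaled R) (scaled r))
      \<le> exp (2 * level_error * total_weight log_max) * 64 * real (covering_number (cball x R \<inter> sponge n D) r)"
    using x(1) by (auto simp: mult.assoc)
qed simp

lemma covering_number_lower:
  "\<exists>C>0. \<forall>R r. 0 < R \<longrightarrow> 0 < r \<longrightarrow> (\<forall>x\<in>sponge n D.
    exp (growth log_min (scaled R) (scaled r)) \<le> C * real (covering_number (cball x R \<inter> sponge n D) r))"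
proof (intro exI[of _ "exp (2 * level_error * total_weight log_min) * 64"] conjI allI impI ballI)
  fix R r :: real and x assume R: "0 < R" and r: "0 < r" and x: "x \<in> sponge n D"
  have le: "ext_product (min_ext D) (high_level (R / 3)) (low_level r)
      \<le> 64 * covering_number (cball x R \<inter> sponge n D) r"
    using min_product_le_covering_number[OF x r, of "high_level (R / 3)" R "low_level r"]
      low_level[OF r] high_level[of "R / 3"] R by simp
  have "exp (growth log_min (scaled R) (scaled r)) \<le> exp (2 * level_error * total_weight log_min)
      * real (ext_product (min_ext D) (high_level (R / 3)) (low_level r))"
    by (intro min_estimate levels_decreasing level_error R r)
  also have "\<dots> \<le> exp (2 * level_error * total_weight log_min) * real (64 * covering_number (cball x R \<inter> sponge n D) r)"
    using le by (intro mult_left_mono of_nat_mono) simp_all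
  finally show "exp (growth log_min (scaled R) (scaled r))
      \<le> exp (2 * level_error * total_weight log_min) * 64 * real (covering_number (cball x R \<inter> sponge n D) r)"
    by (simp add: mult.assoc)
qed simp

text \<open>As the values of \<open>lam\<close> are distinct, the idealised levels drift apart
  linearly in log(1/R) and finally beat the bounded errors. The gap 2 leaves room for two prescribed
  digits per coordinate.\<close>

lemma levels_eventually_apart:
  "\<exists>\<delta>>0. \<forall>R. 0 < R \<and> R < \<delta> \<longrightarrow> low_level R 3 - 3 + 2 \<le> low_level R 2 - 3 \<and> low_level R 2 - 3 + 2 \<le> low_level R 1 - 3"
proof -
  define \<epsilon> where "\<epsilon> = min (lam 1 - lam 2) (lam 2 - lam 3)"
  have \<epsilon>: "0 < \<epsilon>" using lam_less by (simp add: \<epsilon>_def)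
  define t where "t = (2 * level_error + 2) / \<epsilon>"
  show ?thesis
  proof (intro exI[of _ "exp (- t)"] conjI allI impI)
    fix R assume R: "0 < R \<and> R < exp (- t)"
    then have "ln R < - t" by (metis exp_gt_zero ln_exp ln_less_cancel_iff)
    then have "t \<le> log_scale R" using R by (simp add: log_scale_def ln_div)
    then have gap: "2 * level_error + 2 \<le> \<epsilon> * log_scale R" using \<epsilon> by (simp add: t_def field_simps)
    have nn: "0 \<le> log_scale R" by (simp add: log_scale_def)
    have "\<epsilon> * log_scale R \<le> (lam 1 - lam 2) * log_scale R" "\<epsilon> * log_scale R \<le> (lam 2 - lam 3) * log_scale R"
      using nn by (auto intro!: mult_right_mono simp: \<epsilon>_def)
    then have "real (low_level R 3 - 3) + 2 \<le> real (low_level R 2 - 3)"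
      "real (low_level R 2 - 3) + 2 \<le> real (low_level R 1 - 3)"
      using gap level_error(2)[of R 1] level_error(2)[of R 2] level_error(2)[of R 3] R
      unfolding left_diff_distrib abs_le_iff by linarith+
    then show "low_level R 3 - 3 + 2 \<le> low_level R 2 - 3" "low_level R 2 - 3 + 2 \<le> low_level R 1 - 3"
      by linarith+
  qed simp
qed

lemma covering_number_lower_attained:
  "\<exists>C>0. \<exists>\<delta>>0. \<forall>R r. 0 < R \<longrightarrow> R < \<delta> \<longrightarrow> 0 < r \<longrightarrow> (\<exists>x\<in>sponge n D.
    real (covering_number (cball x R \<inter> sponge n D) r) \<le> C * exp (growth log_min (scaled R) (scaled r)))"
proof -
  obtain \<delta> where \<delta>: "0 < \<delta>" "\<And>R. 0 < R \<Longrightarrow> R < \<delta> \<Longrightarrow> low_level R 3 - 3 + 2 \<le> low_level R 2 - 3"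
    "\<And>R. 0 < R \<Longrightarrow> R < \<delta> \<Longrightarrow> low_level R 2 - 3 + 2 \<le> low_level R 1 - 3"
    using levels_eventually_apart by blast
  \<comment> \<open>The exponent 6 is the number of prescribed positions, two for each
    coordinate.\<close>
  define C where "C = real (card D ^ 6) * exp (2 * level_error * total_weight log_min)"
  have "0 < C" using finite_D D_ne by (simp add: C_def card_gt_0_iff)
  moreover have "\<exists>x\<in>sponge n D. real (covering_number (cball x R \<inter> sponge n D) r) \<le> C * exp (growth log_min (scaled R) (scaled r))"
    if R: "0 < R" "R < \<delta>" and r: "0 < r" for R r
  proof -
    \<comment> \<open>Lowering by 3 leaves two positions for the prescribed digits and one to make
      the bound on \<open>R\<close> strict.\<close>
    define L where "L q = low_level R q - 3" for q
    have apart: "L 3 + 2 \<le> L 2" "L 2 + 2 \<le> L 1" using \<delta>(2,3)[OF R] by (simp_all add: L_def)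
    have "L 1 \<noteq> L 2" "L 1 \<noteq> L 3" "L 2 \<noteq> L 3" using apart by linarith+
    then have "L p = L q \<Longrightarrow> p = q" for p q
      using exhaust_3[of p] exhaust_3[of q] by metis
    then have inj: "inj L" by (rule injI)
    have "L 1 \<noteq> Suc (L 2)" "L 1 \<noteq> Suc (L 3)" "L 2 \<noteq> Suc (L 3)"
      "L 2 \<noteq> Suc (L 1)" "L 3 \<noteq> Suc (L 1)" "L 3 \<noteq> Suc (L 2)" using apart by linarith+
    then have "L p \<noteq> Suc (L q)" for p q
      using exhaust_3[of p] exhaust_3[of q] by (metis n_not_Suc_n)
    then have disj: "range L \<inter> range (\<lambda>q. Suc (L q)) = {}" by blast
    have L: "L q = 0 \<or> R < 1 / real (n q) ^ (L q + 2)" for q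
    proof (cases "L q = 0")
      case False
      then have "R \<le> 1 / real (n q) ^ low_level R q" "L q + 2 < low_level R q"
        using low_level[OF R(1), of q] by (auto simp: L_def)
      moreover have "1 / real (n q) ^ low_level R q < 1 / real (n q) ^ (L q + 2)"
        using calculation(2) n_gt_1[of q] n_pos[of q]
        by (intro divide_strict_left_mono power_strict_increasing) auto
      ultimately show ?thesis by linarith
    qed simp
    have "1 / real (n q) ^ high_level (r / 3) q \<le> r / CARD(3)" for q
      using high_level[of "r / 3"] r by simp
    from covering_number_le_min_product[OF L this inj disj]
    obtain x where x: "x \<in> sponge n D" "covering_number (cball x R \<inter> sponge n D) r
      \<le> card D ^ 6 * ext_product (min_ext D) L (high_level (r / 3))" by auto
    have "real (covering_number (cball x R \<inter> sponge n D) r)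
        \<le> real (card D ^ 6 * ext_product (min_ext D) L (high_level (r / 3)))"
      by (rule of_nat_mono[OF x(2)])
    also have "\<dots> = real (card D ^ 6) * real (ext_product (min_ext D) L (high_level (r / 3)))" by simp
    also have "\<dots> \<le> real (card D ^ 6) * (exp (2 * level_error * total_weight log_min) * exp (growth log_min (scaled R) (scaled r)))"
      using apart by (intro mult_left_mono min_estimate levels_decreasing level_error r)
        (auto simp: L_def intro: level_error(2)[OF R(1)])
    finally show ?thesis using x(1) by (auto simp: C_def mult.assoc)
  qed
  ultimately show ?thesis using \<delta>(1) by blast
qed

end

section \<open>Dimensions and spectra\<close>

lemma Inf_positive_reals_eq:
  fixes v :: real
  assumes "0 \<le> v" "\<And>s. v < s \<Longrightarrow> P s" "\<And>s. 0 < s \<Longrightarrow> P s \<Longrightarrow> v \<le> s"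
  shows "Inf {s. 0 < s \<and> P s} = v"
proof (rule antisym)
  have "bdd_below {s. 0 < s \<and> P s}" by (rule bdd_belowI[of _ 0]) auto
  then have "Inf {s. 0 < s \<and> P s} \<le> s" if "v < s" for s
    using that assms(1,2) by (intro cInf_lower) auto
  then show "Inf {s. 0 < s \<and> P s} \<le> v" by (meson dense linorder_not_le)
  have "v + 1 \<in> {s. 0 < s \<and> P s}" using assms(1,2) by simp
  then show "v \<le> Inf {s. 0 < s \<and> P s}" using assms(3) by (intro cInf_greatest) auto
qed

lemma Sup_positive_reals_eq:
  fixes v :: real
  assumes "0 \<le> v" "P v" "\<And>s. 0 < s \<Longrightarrow> P s \<Longrightarrow> s \<le> v"
  shows "Sup (insert 0 {s. 0 < s \<and> P s}) = v"
  using assms by (intro cSup_eq_maximum) (auto simp: le_less)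

lemma scale_ratio_powr:
  fixes R :: real
  assumes "0 < R"
  shows "(R / R powr (1 / \<theta>)) powr s = exp (s * (1 / \<theta> - 1) * ln (1 / R))"
proof -
  have "ln (R / R powr (1 / \<theta>)) = ln R - 1 / \<theta> * ln R"
    using assms by (simp add: ln_div ln_powr)
  also have "\<dots> = (1 / \<theta> - 1) * ln (1 / R)"
    using assms by (simp add: ln_div algebra_simps)
  finally show ?thesis using assms by (simp add: powr_def)
qed

lemma scale_less: "0 < \<theta> \<Longrightarrow> \<theta> < 1 \<Longrightarrow> 0 < R \<Longrightarrow> R < 1 \<Longrightarrow> R powr (1 / \<theta>) < R" for R :: real
  using powr_less_mono'[of R 1 "1 / \<theta>"] by simp

text \<open>As \<open>ln (1 / R)\<close> is unbounded, no constant factor compensates a larger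
  exponential rate.\<close>

lemma exponent_le:
  assumes "0 < \<kappa>" "0 < \<delta>" and "\<And>R. 0 < R \<Longrightarrow> R < \<delta> \<Longrightarrow> R < 1 \<Longrightarrow>
    exp (v * \<kappa> * ln (1 / R)) \<le> K * exp (s * \<kappa> * ln (1 / R))"
  shows "v \<le> (s :: real)"
proof (rule ccontr)
  assume "\<not> v \<le> s"
  then have pos: "0 < (v - s) * \<kappa>" using assms(1) by simp
  \<comment> \<open>At \<open>R = exp (- t)\<close> the entries ensure \<open>R < 1\<close>,
    \<open>R < \<delta>\<close> and \<open>K \<le> (v - s) * \<kappa> * t\<close>; the last
    contradicts exp x >= 1 + x.\<close>
  define t where "t = Max {1, ln (1 / \<delta>) + 1, K / ((v - s) * \<kappa>)}"
  have t: "1 \<le> t" "ln (1 / \<delta>) + 1 \<le> t" "K / ((v - s) * \<kappa>) \<le> t"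
    unfolding t_def by (auto intro: Max_ge)
  have "exp (- t) < exp (ln \<delta>)" using t(2) assms(2) by (subst exp_less_cancel_iff) (simp add: ln_div)
  then have "exp (v * \<kappa> * t) \<le> K * exp (s * \<kappa> * t)"
    using assms(3)[of "exp (- t)"] t(1) assms(2) by (simp add: ln_div)
  then have "exp ((v - s) * \<kappa> * t) \<le> K"
    by (simp add: left_diff_distrib exp_diff divide_le_eq)
  moreover have "K \<le> (v - s) * \<kappa> * t"
    using t(3) pos by (simp add: pos_divide_le_eq mult.commute)
  ultimately show False using exp_ge_add_one_self[of "(v - s) * \<kappa> * t"] by linarith
qed

lemma assouad_exponent_ge:
  fixes F :: "'a::metric_space set"
  assumes \<theta>: "0 < \<theta>" "\<theta> < 1" and "0 < \<delta>" "0 < C"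
    and large: "\<And>R. 0 < R \<Longrightarrow> R < \<delta> \<Longrightarrow> R < 1 \<Longrightarrow> \<exists>x\<in>F. (R / R powr (1 / \<theta>)) powr v
      \<le> C * real (covering_number (cball x R \<inter> F) (R powr (1 / \<theta>)))"
    and s: "\<exists>C>0. \<forall>R. 0 < R \<and> R < 1 \<longrightarrow> (\<forall>x\<in>F.
      real (covering_number (cball x R \<inter> F) (R powr (1 / \<theta>))) \<le> C * (R / R powr (1 / \<theta>)) powr s)"
  shows "v \<le> s"
proof -
  obtain C' where C': "0 < C'" "\<And>R x. 0 < R \<Longrightarrow> R < 1 \<Longrightarrow> x \<in> F \<Longrightarrow>
      real (covering_number (cball x R \<inter> F) (R powr (1 / \<theta>))) \<le> C' * (R / R powr (1 / \<theta>)) powr s"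
    using s by blast
  show ?thesis
  proof (rule exponent_le[of "1 / \<theta> - 1" \<delta> v "C * C'" s])
    fix R :: real assume R: "0 < R" "R < \<delta>" "R < 1"
    then obtain x where x: "x \<in> F" "(R / R powr (1 / \<theta>)) powr v
      \<le> C * real (covering_number (cball x R \<inter> F) (R powr (1 / \<theta>)))" using large by blast
    have "(R / R powr (1 / \<theta>)) powr v \<le> C * (C' * (R / R powr (1 / \<theta>)) powr s)"
      using x(2) mult_left_mono[OF C'(2)[OF R(1,3) x(1)], of C] \<open>0 < C\<close> by linarith
    then show "exp (v * (1 / \<theta> - 1) * ln (1 / R)) \<le> C * C' * exp (s * (1 / \<theta> - 1) * ln (1 / R))"
      unfolding scale_ratio_powr[OF R(1)] by (simp only: mult.assoc)
  qed (use assms in auto)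
qed

lemma lower_exponent_le:
  fixes F :: "'a::metric_space set"
  assumes \<theta>: "0 < \<theta>" "\<theta> < 1" and "0 < \<delta>" "0 < C"
    and small: "\<And>R. 0 < R \<Longrightarrow> R < \<delta> \<Longrightarrow> R < 1 \<Longrightarrow> \<exists>x\<in>F.
      real (covering_number (cball x R \<inter> F) (R powr (1 / \<theta>))) \<le> C * (R / R powr (1 / \<theta>)) powr v"
    and s: "\<exists>C>0. \<forall>R. 0 < R \<and> R < 1 \<longrightarrow> (\<forall>x\<in>F.
      real (covering_number (cball x R \<inter> F) (R powr (1 / \<theta>))) \<ge> C * (R / R powr (1 / \<theta>)) powr s)"
  shows "s \<le> v"
proof -
  obtain C' where C': "0 < C'" "\<And>R x. 0 < R \<Longrightarrow> R < 1 \<Longrightarrow> x \<in> F \<Longrightarrow>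
      C' * (R / R powr (1 / \<theta>)) powr s \<le> real (covering_number (cball x R \<inter> F) (R powr (1 / \<theta>)))"
    using s by blast
  show ?thesis
  proof (rule exponent_le[of "1 / \<theta> - 1" \<delta> s "C / C'" v])
    fix R :: real assume R: "0 < R" "R < \<delta>" "R < 1"
    then obtain x where x: "x \<in> F" "real (covering_number (cball x R \<inter> F) (R powr (1 / \<theta>)))
      \<le> C * (R / R powr (1 / \<theta>)) powr v" using small by blast
    have "C' * (R / R powr (1 / \<theta>)) powr s \<le> C * (R / R powr (1 / \<theta>)) powr v"
      using x(2) C'(2)[OF R(1,3) x(1)] by linarith
    then have "(R / R powr (1 / \<theta>)) powr s \<le> C / C' * (R / R powr (1 / \<theta>)) powr v"
      using C'(1) by (simp add: pos_le_divide_eq mult.commute)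
    then show "exp (s * (1 / \<theta> - 1) * ln (1 / R)) \<le> C / C' * exp (v * (1 / \<theta> - 1) * ln (1 / R))"
      unfolding scale_ratio_powr[OF R(1)] .
  qed (use assms in auto)
qed

context digit_system3
begin

text \<open>In units of log(1/r) with \<open>r = R powr (1 / \<theta>)\<close>, the levels of
  \<open>R\<close> and \<open>r\<close> are \<open>\<theta> * lam q\<close> and
  \<open>lam q\<close>, and log(R/r) is \<open>1 - \<theta>\<close>.\<close>

definition spectrum_value :: "(3 set \<Rightarrow> 3 set \<Rightarrow> real) \<Rightarrow> real \<Rightarrow> real" where
  "spectrum_value w \<theta> = growth w (\<lambda>q. \<theta> * lam q) lam / (1 - \<theta>)"

text \<open>For \<open>log_max\<close> this is log|pi_1 D|/log n_1 + log M_max/log n_2 + log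
  N_max/log n_3, the candidate for the Assouad dimension; \<open>log_min\<close> gives the candidate
  for the lower dimension.\<close>

definition split_value :: "(3 set \<Rightarrow> 3 set \<Rightarrow> real) \<Rightarrow> real" where
  "split_value w = w {} {1} * lam 1 + w {1} {1, 2} * lam 2 + w {1, 2} UNIV * lam 3"

lemma log_max_nonneg: "0 \<le> log_max S T" and log_min_nonneg: "0 \<le> log_min S T"
  using max_ext_ge_1[of S T] min_ext_ge_1[of S T] by (simp_all add: log_max_def log_min_def)

lemma log_max_mult: "S \<subseteq> T \<Longrightarrow> T \<subseteq> U \<Longrightarrow> log_max S U \<le> log_max S T + log_max T U"
proof -
  assume "S \<subseteq> T" "T \<subseteq> U"
  then have "real (max_ext D S U) \<le> real (max_ext D S T) * real (max_ext D T U)"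
    using max_ext_mult[of S T U] by (simp flip: of_nat_mult)
  then have "ln (real (max_ext D S U)) \<le> ln (real (max_ext D S T) * real (max_ext D T U))"
    using max_ext_ge_1[of S U] by (intro ln_mono) auto
  then show ?thesis
    using max_ext_ge_1[of S T] max_ext_ge_1[of T U] by (simp add: log_max_def ln_mult)
qed

lemma log_min_mult: "S \<subseteq> T \<Longrightarrow> T \<subseteq> U \<Longrightarrow> log_min S T + log_min T U \<le> log_min S U"
proof -
  assume "S \<subseteq> T" "T \<subseteq> U"
  then have "real (min_ext D S T) * real (min_ext D T U) \<le> real (min_ext D S U)"
    using min_ext_mult[of S T U] by (simp flip: of_nat_mult)
  then have "ln (real (min_ext D S T) * real (min_ext D T U)) \<le> ln (real (min_ext D S U))"
    using min_ext_ge_1[of S T] min_ext_ge_1[of T U] by (intro ln_mono) auto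
  then show ?thesis
    using min_ext_ge_1[of S T] min_ext_ge_1[of T U] by (simp add: log_min_def ln_mult)
qed

lemma growth_nonneg: "(\<And>S T. 0 \<le> w S T) \<Longrightarrow> 0 \<le> growth w a b"
  by (simp add: growth_def overlap_nonneg)

lemma spectrum_value_nonneg:
  "\<theta> < 1 \<Longrightarrow> 0 \<le> spectrum_value log_max \<theta>" "\<theta> < 1 \<Longrightarrow> 0 \<le> spectrum_value log_min \<theta>"
  by (simp_all add: spectrum_value_def growth_nonneg log_max_nonneg log_min_nonneg)

lemma split_value_nonneg: "0 \<le> split_value log_max" "0 \<le> split_value log_min"
  using lam_pos by (simp_all add: split_value_def log_max_nonneg log_min_nonneg less_imp_le)

lemma exp_growth_spectrum:
  assumes "0 < \<theta>" "\<theta> < 1" "0 < R" "R < 1"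
  shows "exp (growth w (scaled R) (scaled (R powr (1 / \<theta>)))) = (R / R powr (1 / \<theta>)) powr spectrum_value w \<theta>"
proof -
  let ?t = "ln (1 / R)"
  have t: "0 < ?t" using assms by simp
  have "log_scale R = ?t" "log_scale (R powr (1 / \<theta>)) = ?t / \<theta>"
    using assms t by (auto simp: log_scale_def ln_div ln_powr max_def divide_le_0_iff)
  then have "growth w (scaled R) (scaled (R powr (1 / \<theta>))) =
      growth w (\<lambda>q. (?t / \<theta>) * (\<theta> * lam q)) (\<lambda>q. (?t / \<theta>) * lam q)"
    using assms by (simp add: mult_ac)
  also have "\<dots> = (?t / \<theta>) * growth w (\<lambda>q. \<theta> * lam q) lam"
    using t assms by (intro growth_scale) simp
  also have "\<dots> = spectrum_value w \<theta> * (1 / \<theta> - 1) * ?t"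
    using assms by (simp add: spectrum_value_def field_simps)
  finally show ?thesis using assms by (simp only: scale_ratio_powr)
qed

text \<open>Kept separate because it also bounds the Assouad dimension from below, through the scale
  pairs of a single \<open>\<theta>\<close>.\<close>

lemma sponge_exponent_ge:
  assumes "0 < \<theta>" "\<theta> < 1"
    and "\<exists>C>0. \<forall>R. 0 < R \<and> R < 1 \<longrightarrow> (\<forall>x\<in>sponge n D.
      real (covering_number (cball x R \<inter> sponge n D) (R powr (1 / \<theta>))) \<le> C * (R / R powr (1 / \<theta>)) powr s)"
  shows "spectrum_value log_max \<theta> \<le> s"
proof -
  obtain C where C: "0 < C" "\<And>R r. 0 < R \<Longrightarrow> 0 < r \<Longrightarrow> \<exists>x\<in>sponge n D.
      exp (growth log_max (scaled R) (scaled r)) \<le> C * real (covering_number (cball x R \<inter> sponge n D) r)"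
    using covering_number_upper_attained by blast
  show ?thesis
  proof (rule assouad_exponent_ge[OF assms(1,2) zero_less_one C(1) _ assms(3)])
    fix R :: real assume "0 < R" "R < 1" "R < 1"
    then show "\<exists>x\<in>sponge n D. (R / R powr (1 / \<theta>)) powr spectrum_value log_max \<theta>
        \<le> C * real (covering_number (cball x R \<inter> sponge n D) (R powr (1 / \<theta>)))"
      using C(2)[of R "R powr (1 / \<theta>)"] exp_growth_spectrum[OF assms(1,2), of R log_max] by simp
  qed
qed

lemma sponge_exponent_le:
  assumes "0 < \<theta>" "\<theta> < 1"
    and "\<exists>C>0. \<forall>R. 0 < R \<and> R < 1 \<longrightarrow> (\<forall>x\<in>sponge n D.
      real (covering_number (cball x R \<inter> sponge n D) (R powr (1 / \<theta>))) \<ge> C * (R / R powr (1 / \<theta>)) powr s)"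
  shows "s \<le> spectrum_value log_min \<theta>"
proof -
  obtain C \<delta> where C: "0 < C" "0 < \<delta>" "\<And>R r. 0 < R \<Longrightarrow> R < \<delta> \<Longrightarrow> 0 < r \<Longrightarrow> \<exists>x\<in>sponge n D.
      real (covering_number (cball x R \<inter> sponge n D) r) \<le> C * exp (growth log_min (scaled R) (scaled r))"
    using covering_number_lower_attained by blast
  show ?thesis
  proof (rule lower_exponent_le[OF assms(1,2) C(2,1) _ assms(3)])
    fix R :: real assume "0 < R" "R < \<delta>" "R < 1"
    then show "\<exists>x\<in>sponge n D. real (covering_number (cball x R \<inter> sponge n D) (R powr (1 / \<theta>)))
        \<le> C * (R / R powr (1 / \<theta>)) powr spectrum_value log_min \<theta>"
      using C(3)[of R "R powr (1 / \<theta>)"] exp_growth_spectrum[OF assms(1,2), of R log_min] by simp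
  qed
qed

theorem assouad_spectrum_sponge:
  assumes \<theta>: "0 < \<theta>" "\<theta> < 1"
  shows "assouad_spectrum \<theta> (sponge n D) = spectrum_value log_max \<theta>"
  unfolding assouad_spectrum_def
proof (rule Inf_positive_reals_eq)
  obtain C where C: "0 < C" "\<And>x R r. 0 < R \<Longrightarrow> 0 < r \<Longrightarrow>
      real (covering_number (cball x R \<inter> sponge n D) r) \<le> C * exp (growth log_max (scaled R) (scaled r))"
    using covering_number_upper by blast
  fix s assume s: "spectrum_value log_max \<theta> < s"
  show "\<exists>C>0. \<forall>R. 0 < R \<and> R < 1 \<longrightarrow> (\<forall>x\<in>sponge n D.
      real (covering_number (cball x R \<inter> sponge n D) (R powr (1 / \<theta>))) \<le> C * (R / R powr (1 / \<theta>)) powr s)"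
  proof (intro exI[of _ C] conjI allI impI ballI C(1))
    fix R :: real and x assume R: "0 < R \<and> R < 1"
    then have "real (covering_number (cball x R \<inter> sponge n D) (R powr (1 / \<theta>)))
        \<le> C * (R / R powr (1 / \<theta>)) powr spectrum_value log_max \<theta>"
      using C(2)[of R "R powr (1 / \<theta>)" x] exp_growth_spectrum[OF \<theta>, of R log_max] by simp
    also have "\<dots> \<le> C * (R / R powr (1 / \<theta>)) powr s"
      using C(1) s R scale_less[OF \<theta>, of R] by (intro mult_left_mono powr_mono) auto
    finally show "real (covering_number (cball x R \<inter> sponge n D) (R powr (1 / \<theta>)))
        \<le> C * (R / R powr (1 / \<theta>)) powr s" .
  qed
qed (use \<theta> sponge_exponent_ge[OF \<theta>] in \<open>auto simp: spectrum_value_nonneg\<close>)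

theorem lower_spectrum_sponge:
  assumes \<theta>: "0 < \<theta>" "\<theta> < 1"
  shows "lower_spectrum \<theta> (sponge n D) = spectrum_value log_min \<theta>"
  unfolding lower_spectrum_def
proof (rule Sup_positive_reals_eq)
  obtain C where C: "0 < C" "\<And>x R r. 0 < R \<Longrightarrow> 0 < r \<Longrightarrow> x \<in> sponge n D \<Longrightarrow>
      exp (growth log_min (scaled R) (scaled r)) \<le> C * real (covering_number (cball x R \<inter> sponge n D) r)"
    using covering_number_lower by blast
  show "\<exists>C>0. \<forall>R. 0 < R \<and> R < 1 \<longrightarrow> (\<forall>x\<in>sponge n D.
      real (covering_number (cball x R \<inter> sponge n D) (R powr (1 / \<theta>)))
        \<ge> C * (R / R powr (1 / \<theta>)) powr spectrum_value log_min \<theta>)"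
  proof (intro exI[of _ "1 / C"] conjI allI impI ballI)
    fix R :: real and x assume R: "0 < R \<and> R < 1" and x: "x \<in> sponge n D"
    have "(R / R powr (1 / \<theta>)) powr spectrum_value log_min \<theta>
        \<le> C * real (covering_number (cball x R \<inter> sponge n D) (R powr (1 / \<theta>)))"
      using C(2)[of R "R powr (1 / \<theta>)" x] exp_growth_spectrum[OF \<theta>, of R log_min] R x by simp
    then show "1 / C * (R / R powr (1 / \<theta>)) powr spectrum_value log_min \<theta>
        \<le> real (covering_number (cball x R \<inter> sponge n D) (R powr (1 / \<theta>)))"
      using C(1) by (simp add: pos_divide_le_eq mult.commute)
  qed (use C(1) in simp)
qed (use \<theta> sponge_exponent_le[OF \<theta>] in \<open>auto simp: spectrum_value_nonneg\<close>)

section \<open>Assouad and lower dimension\<close>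

lemma scaled_decreasing: "scaled u 3 \<le> scaled u 2" "scaled u 2 \<le> scaled u 1"
  using lam_less by (auto intro!: mult_right_mono simp: log_scale_def)

lemma scaled_mono:
  assumes "0 < r" "r \<le> R" shows "scaled R q \<le> scaled r q"
proof -
  have "ln (1 / R) \<le> ln (1 / r)" using assms by (simp add: ln_div)
  then show ?thesis using lam_pos[of q] by (intro mult_left_mono) (auto simp: log_scale_def)
qed

lemma split_value_scaled:
  "w {} {1} * (scaled r 1 - scaled R 1) + w {1} {1, 2} * (scaled r 2 - scaled R 2)
    + w {1, 2} UNIV * (scaled r 3 - scaled R 3) = split_value w * (log_scale r - log_scale R)"
  by (simp add: split_value_def algebra_simps)

text \<open>Subadditivity of \<open>log_max\<close> bounds the growth at all pairs of scales.
  Conversely, by \<open>eq\<close> the pairs \<open>R\<close>, \<open>R powr (1 / \<theta>)\<close>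
  alone already force this exponent.\<close>

theorem assouad_dim_sponge:
  assumes \<theta>: "0 < \<theta>" "\<theta> < 1" and eq: "spectrum_value log_max \<theta> = split_value log_max"
  shows "assouad_dim (sponge n D) = split_value log_max"
  unfolding assouad_dim_def
proof (rule Inf_positive_reals_eq)
  obtain C where C: "0 < C" "\<And>x R r. 0 < R \<Longrightarrow> 0 < r \<Longrightarrow>
      real (covering_number (cball x R \<inter> sponge n D) r) \<le> C * exp (growth log_max (scaled R) (scaled r))"
    using covering_number_upper by blast
  fix s assume s: "split_value log_max < s"
  show "\<exists>C>0. \<forall>x\<in>sponge n D. \<forall>r R. 0 < r \<and> r < R \<longrightarrow>
      real (covering_number (cball x R \<inter> sponge n D) r) \<le> C * (R / r) powr s"
  proof (intro exI[of _ C] conjI allI impI ballI C(1))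
    fix r R :: real and x assume R: "0 < r \<and> r < R"
    have "growth log_max (scaled R) (scaled r) \<le> split_value log_max * (log_scale r - log_scale R)"
      using growth_le_split[where a = "scaled R" and b = "scaled r" and w = log_max,
        OF scaled_decreasing scaled_decreasing scaled_mono log_max_mult] R
      unfolding split_value_scaled by simp
    \<comment> \<open>Only an inequality, since \<open>R > 1\<close> is allowed and
      \<open>log_scale\<close> is cut off there.\<close>
    also have "log_scale r - log_scale R \<le> ln (R / r)"
      using R by (auto simp: log_scale_def ln_div max_def)
    then have "split_value log_max * (log_scale r - log_scale R) \<le> s * ln (R / r)"
      using s R split_value_nonneg by (intro mult_mono) (auto simp: log_scale_def ln_div max_def)
    finally have "exp (growth log_max (scaled R) (scaled r)) \<le> (R / r) powr s"
      using R by (simp add: powr_def)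
    then show "real (covering_number (cball x R \<inter> sponge n D) r) \<le> C * (R / r) powr s"
      using C(2)[of R r x] mult_left_mono[of _ _ C] C(1) R by (smt (verit))
  qed
next
  fix s assume "\<exists>C>0. \<forall>x\<in>sponge n D. \<forall>r R. 0 < r \<and> r < R \<longrightarrow>
      real (covering_number (cball x R \<inter> sponge n D) r) \<le> C * (R / r) powr s"
  then obtain C where "0 < C" "\<And>x r R. x \<in> sponge n D \<Longrightarrow> 0 < r \<Longrightarrow> r < R \<Longrightarrow>
      real (covering_number (cball x R \<inter> sponge n D) r) \<le> C * (R / r) powr s" by blast
  then have "\<exists>C>0. \<forall>R. 0 < R \<and> R < 1 \<longrightarrow> (\<forall>x\<in>sponge n D.
      real (covering_number (cball x R \<inter> sponge n D) (R powr (1 / \<theta>))) \<le> C * (R / R powr (1 / \<theta>)) powr s)"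
    using scale_less[OF \<theta>] by (intro exI[of _ C]) auto
  then show "split_value log_max \<le> s" using sponge_exponent_ge[OF \<theta>] eq by simp
qed (simp add: split_value_nonneg)

theorem lower_dim_sponge:
  assumes \<theta>: "0 < \<theta>" "\<theta> < 1" and eq: "spectrum_value log_min \<theta> = split_value log_min"
  shows "lower_dim (sponge n D) = split_value log_min"
  unfolding lower_dim_def
proof (rule Sup_positive_reals_eq)
  obtain C where C: "0 < C" "\<And>x R r. 0 < R \<Longrightarrow> 0 < r \<Longrightarrow> x \<in> sponge n D \<Longrightarrow>
      exp (growth log_min (scaled R) (scaled r)) \<le> C * real (covering_number (cball x R \<inter> sponge n D) r)"
    using covering_number_lower by blast
  show "\<exists>C>0. \<forall>x\<in>sponge n D. \<forall>r R. 0 < r \<and> r < R \<and> R < 1 \<longrightarrow>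
      real (covering_number (cball x R \<inter> sponge n D) r) \<ge> C * (R / r) powr split_value log_min"
  proof (intro exI[of _ "1 / C"] conjI allI impI ballI)
    fix r R :: real and x assume R: "0 < r \<and> r < R \<and> R < 1" and x: "x \<in> sponge n D"
    \<comment> \<open>Both scales are below 1, so nothing is cut off and equality holds.\<close>
    have "log_scale r = - ln r" "log_scale R = - ln R" using R by (auto simp: log_scale_def ln_div)
    then have "split_value log_min * ln (R / r) = split_value log_min * (log_scale r - log_scale R)"
      using R by (simp add: ln_div)
    also have "\<dots> \<le> growth log_min (scaled R) (scaled r)"
      using growth_ge_split[where a = "scaled R" and b = "scaled r" and w = log_min,
        OF scaled_decreasing scaled_decreasing scaled_mono log_min_mult] R
      unfolding split_value_scaled by simp
    finally have "(R / r) powr split_value log_min \<le> exp (growth log_min (scaled R) (scaled r))"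
      using R by (simp add: powr_def)
    also have "\<dots> \<le> C * real (covering_number (cball x R \<inter> sponge n D) r)"
      using C(2) R x by simp
    finally show "1 / C * (R / r) powr split_value log_min \<le> real (covering_number (cball x R \<inter> sponge n D) r)"
      using C(1) by (simp add: pos_divide_le_eq mult.commute)
  qed (use C(1) in simp)
next
  fix s assume "\<exists>C>0. \<forall>x\<in>sponge n D. \<forall>r R. 0 < r \<and> r < R \<and> R < 1 \<longrightarrow>
      real (covering_number (cball x R \<inter> sponge n D) r) \<ge> C * (R / r) powr s"
  then obtain C where "0 < C" "\<And>x r R. x \<in> sponge n D \<Longrightarrow> 0 < r \<Longrightarrow> r < R \<Longrightarrow> R < 1 \<Longrightarrow>
      C * (R / r) powr s \<le> real (covering_number (cball x R \<inter> sponge n D) r)" by blast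
  then have "\<exists>C>0. \<forall>R. 0 < R \<and> R < 1 \<longrightarrow> (\<forall>x\<in>sponge n D.
      real (covering_number (cball x R \<inter> sponge n D) (R powr (1 / \<theta>))) \<ge> C * (R / R powr (1 / \<theta>)) powr s)"
    using scale_less[OF \<theta>] by (intro exI[of _ C]) auto
  then show "s \<le> split_value log_min" using sponge_exponent_le[OF \<theta>] eq by simp
qed (simp add: split_value_nonneg)

section \<open>Box dimension\<close>

lemma sponge_in_cball: "x \<in> sponge n D \<Longrightarrow> cball x 3 \<inter> sponge n D = sponge n D"
  using coding_map_dist_le[of _ _ "\<lambda>_. 0" 3] by (auto simp: sponge_eq agree_def)

text \<open>A ball of radius 3 about a point of the sponge contains all of it, and
  \<open>log_scale 3 = 0\<close>. So the sponge is the case of coarse levels 0, and the constants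
  vanish after division by log(1/r).\<close>

theorem box_dim_sponge: "box_dim (sponge n D) = growth log_max (\<lambda>_. 0) lam"
proof -
  define B where "B = growth log_max (\<lambda>_. 0) lam"
  let ?N = "\<lambda>r. real (covering_number (sponge n D) r)"
  obtain C1 where C1: "0 < C1" "\<And>x R r. 0 < R \<Longrightarrow> 0 < r \<Longrightarrow>
      real (covering_number (cball x R \<inter> sponge n D) r) \<le> C1 * exp (growth log_max (scaled R) (scaled r))"
    using covering_number_upper by blast
  obtain C2 where C2: "0 < C2" "\<And>R r. 0 < R \<Longrightarrow> 0 < r \<Longrightarrow> \<exists>x\<in>sponge n D.
      exp (growth log_max (scaled R) (scaled r)) \<le> C2 * real (covering_number (cball x R \<inter> sponge n D) r)"
    using covering_number_upper_attained by blast
  obtain x0 where x0: "x0 \<in> sponge n D" using words_ne by (auto simp: sponge_eq)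
  have bounds: "B - ln C2 / ln (1 / r) \<le> ln (?N r) / ln (1 / r) \<and>
      ln (?N r) / ln (1 / r) \<le> B + ln C1 / ln (1 / r)" if r: "0 < r" "r < 1" for r
  proof -
    have t: "0 < ln (1 / r)" using r by simp
    have "growth log_max (scaled 3) (scaled r) = growth log_max (\<lambda>q. ln (1 / r) * 0) (\<lambda>q. ln (1 / r) * lam q)"
      using t by (simp add: log_scale_def mult.commute ln_div max_def)
    also have "\<dots> = ln (1 / r) * B" unfolding B_def using t by (intro growth_scale) simp
    finally have g: "growth log_max (scaled 3) (scaled r) = ln (1 / r) * B" .
    have up: "?N r \<le> C1 * exp (ln (1 / r) * B)"
      using C1(2)[of 3 r x0] r sponge_in_cball[OF x0] g by simp
    have lo: "exp (ln (1 / r) * B) \<le> C2 * ?N r"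
      using C2(2)[of 3 r] r sponge_in_cball g by auto
    then have N: "0 < ?N r" using C2(1) by (metis exp_gt_zero order_less_le_trans zero_less_mult_pos)
    have "ln (?N r) \<le> ln C1 + ln (1 / r) * B"
      using ln_mono[OF up N] C1(1) by (simp add: ln_mult)
    moreover have "ln (1 / r) * B \<le> ln C2 + ln (?N r)"
      using ln_mono[OF lo exp_gt_zero] C2(1) N by (simp add: ln_mult)
    ultimately have "(ln (1 / r) * B - ln C2) / ln (1 / r) \<le> ln (?N r) / ln (1 / r)"
      "ln (?N r) / ln (1 / r) \<le> (ln C1 + ln (1 / r) * B) / ln (1 / r)"
      using t by (auto intro!: divide_right_mono)
    then show ?thesis using t by (simp add: diff_divide_distrib add_divide_distrib)
  qed
  have "filterlim (\<lambda>r::real. ln (1 / r)) at_top (at_right 0)"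
    unfolding inverse_eq_divide[symmetric]
    by (rule filterlim_compose[OF ln_at_top filterlim_inverse_at_top_right])
  then have lim: "((\<lambda>r. c / ln (1 / r)) \<longlongrightarrow> 0) (at_right 0)" for c :: real
    by (intro tendsto_divide_0[OF tendsto_const] filterlim_at_top_imp_at_infinity)
  have "((\<lambda>r. B - ln C2 / ln (1 / r)) \<longlongrightarrow> B - 0) (at_right 0)"
    "((\<lambda>r. B + ln C1 / ln (1 / r)) \<longlongrightarrow> B + 0) (at_right 0)"
    by (rule tendsto_diff tendsto_add, rule tendsto_const, rule lim)+
  moreover have "eventually (\<lambda>r::real. 0 < r \<and> r < 1) (at_right 0)"
    using eventually_at_right_real[of 0 1] by (simp add: eventually_mono)
  then have "eventually (\<lambda>r. B - ln C2 / ln (1 / r) \<le> ln (?N r) / ln (1 / r)) (at_right 0)"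
    "eventually (\<lambda>r. ln (?N r) / ln (1 / r) \<le> B + ln C1 / ln (1 / r)) (at_right 0)"
    using bounds by (auto elim!: eventually_mono)
  ultimately have "((\<lambda>r. ln (?N r) / ln (1 / r)) \<longlongrightarrow> B) (at_right 0)"
    using tendsto_sandwich[of "\<lambda>r. B - ln C2 / ln (1 / r)" "\<lambda>r. ln (?N r) / ln (1 / r)" "at_right 0"
        "\<lambda>r. B + ln C1 / ln (1 / r)" B] by simp
  then show ?thesis unfolding box_dim_def B_def[symmetric] by (intro tendsto_Lim) auto
qed

end

section \<open>Evaluation of the exponents\<close>

lemma restrict_UNIV: "restrict f UNIV = f"
  by (simp add: restrict_def)

lemma second_digits: "(\<lambda>j. j 2) ` {j \<in> D. j 1 = a} = {i2. (a, i2) \<in> proj2 D}"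
  by (fastforce simp: proj2_def image_iff)

context digit_system3
begin

lemma extensions_empty_1: "extensions D {} {1} i = card (proj1 D)"
  unfolding extensions_def proj1_def
  using finite_D by (simp, intro card_image_eq_image) (auto simp: restrict_eq_iff)

lemma extensions_empty_12: "extensions D {} {1, 2} i = card (proj2 D)"
  unfolding extensions_def proj2_def
  using finite_D by (simp, intro card_image_eq_image) (auto simp: restrict_eq_iff)

lemma extensions_empty_UNIV: "extensions D {} UNIV i = card D"
  by (simp add: extensions_def restrict_UNIV)

lemma extensions_1_12: "extensions D {1} {1, 2} i = fibre1 D (i 1)"
proof -
  have "extensions D {1} {1, 2} i = card ((\<lambda>j. j 2) ` {j \<in> D. j 1 = i 1})"
    unfolding extensions_def
    using finite_D by (simp, intro card_image_eq_image) (auto simp: restrict_eq_iff)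
  then show ?thesis by (simp add: fibre1_def second_digits)
qed

lemma extensions_12_UNIV: "extensions D {1, 2} UNIV i = fibre2 D (i 1, i 2)"
proof -
  \<comment> \<open>With two entries fixed, a digit vector is determined by the third.\<close>
  have "extensions D {1, 2} UNIV i = card ((\<lambda>j. j 3) ` {j \<in> D. j 1 = i 1 \<and> j 2 = i 2})"
    unfolding extensions_def
    using finite_D by (simp add: restrict_UNIV, intro card_image_eq_image[where f = "\<lambda>j. j", simplified])
      (auto simp: fun_eq_iff forall_3)
  also have "(\<lambda>j. j 3) ` {j \<in> D. j 1 = i 1 \<and> j 2 = i 2} = {i3. \<exists>j\<in>D. (j 1, j 2) = (i 1, i 2) \<and> j 3 = i3}"
    by auto
  finally show ?thesis by (simp add: fibre2_def)
qed

lemma extensions_1_UNIV: "extensions D {1} UNIV i = column_sum D (i 1)"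
proof -
  let ?W = "{j \<in> D. j 1 = i 1}"
  have "extensions D {1} UNIV i = card ((\<lambda>j. j) ` ?W)" by (simp add: extensions_def restrict_UNIV)
  also have "\<dots> = (\<Sum>c\<in>(\<lambda>j. j 2) ` ?W. card ((\<lambda>j. j) ` {j \<in> ?W. j 2 = c}))"
    using finite_D by (intro card_image_fibres) auto
  also have "\<dots> = (\<Sum>c\<in>(\<lambda>j. j 2) ` ?W. fibre2 D (i 1, c))"
  proof (rule sum.cong)
    fix c assume "c \<in> (\<lambda>j. j 2) ` ?W"
    then obtain j where "j \<in> D" "j 1 = i 1" "j 2 = c" by auto
    then have "fibre2 D (i 1, c) = extensions D {1, 2} UNIV j" by (simp add: extensions_12_UNIV)
    also have "\<dots> = card ((\<lambda>j. j) ` {j \<in> ?W. j 2 = c})"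
      using \<open>j 1 = i 1\<close> \<open>j 2 = c\<close> by (simp add: extensions_def restrict_UNIV conj_assoc)
    finally show "card ((\<lambda>j. j) ` {j \<in> ?W. j 2 = c}) = fibre2 D (i 1, c)" by simp
  qed simp
  finally show ?thesis by (simp add: column_sum_def second_digits)
qed

text \<open>From \<open>S = {}\<close> the count does not depend on the digit, so maximum and
  minimum agree there; only the other three weights distinguish the two spectra.\<close>

lemma max_ext_values:
  "max_ext D {} {1} = card (proj1 D)" "max_ext D {} {1, 2} = card (proj2 D)" "max_ext D {} UNIV = card D"
  "max_ext D {1} {1, 2} = M_max D" "max_ext D {1} UNIV = C_max D" "max_ext D {1, 2} UNIV = N_max D"
  using D_ne
  by (simp_all add: max_ext_def extensions_empty_1 extensions_empty_12 extensions_empty_UNIV extensions_1_12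
      extensions_1_UNIV extensions_12_UNIV M_max_def C_max_def N_max_def proj1_def proj2_def image_image image_constant_conv)

lemma min_ext_values:
  "min_ext D {} {1} = card (proj1 D)" "min_ext D {} {1, 2} = card (proj2 D)" "min_ext D {} UNIV = card D"
  "min_ext D {1} {1, 2} = M_min D" "min_ext D {1} UNIV = C_min D" "min_ext D {1, 2} UNIV = N_min D"
  using D_ne
  by (simp_all add: min_ext_def extensions_empty_1 extensions_empty_12 extensions_empty_UNIV extensions_1_12
      extensions_1_UNIV extensions_12_UNIV M_min_def C_min_def N_min_def proj1_def proj2_def image_image image_constant_conv)

text \<open>Each case fixes the order of the coarse levels \<open>a\<close> among the fine levels
  \<open>lam\<close>, so every overlap is 0 or a difference of two levels. In the last case each
  position releases at most one coordinate.\<close>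

lemma growth_regimes:
  fixes w :: "3 set \<Rightarrow> 3 set \<Rightarrow> real"
  assumes "0 < \<theta>" "\<theta> < 1"
  defines "a \<equiv> \<lambda>q. \<theta> * lam q"
  shows "\<theta> * lam 1 \<le> lam 3 \<Longrightarrow> growth w a lam =
      w {1, 2} UNIV * (a 2 - a 3) + w {1} UNIV * (a 1 - a 2) + w {} UNIV * (lam 3 - a 1)
      + w {} {1, 2} * (lam 2 - lam 3) + w {} {1} * (lam 1 - lam 2)"
    and "lam 3 \<le> \<theta> * lam 1 \<Longrightarrow> \<theta> * lam 2 \<le> lam 3 \<Longrightarrow> \<theta> * lam 1 \<le> lam 2 \<Longrightarrow> growth w a lam =
      w {1, 2} UNIV * (a 2 - a 3) + w {1} UNIV * (lam 3 - a 2) + w {1} {1, 2} * (a 1 - lam 3)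
      + w {} {1, 2} * (lam 2 - a 1) + w {} {1} * (lam 1 - lam 2)"
    and "lam 3 \<le> \<theta> * lam 2 \<Longrightarrow> \<theta> * lam 1 \<le> lam 2 \<Longrightarrow> growth w a lam =
      w {1, 2} UNIV * (lam 3 - a 3) + w {1} {1, 2} * (a 1 - a 2)
      + w {} {1, 2} * (lam 2 - a 1) + w {} {1} * (lam 1 - lam 2)"
    and "lam 3 \<le> \<theta> * lam 2 \<Longrightarrow> lam 2 \<le> \<theta> * lam 1 \<Longrightarrow> growth w a lam = (1 - \<theta>) * split_value w"
proof -
  have o: "a 3 \<le> a 2" "a 2 \<le> a 1" "lam 3 \<le> lam 2" "lam 2 \<le> lam 1" "a 1 \<le> lam 1" "a 2 \<le> lam 2" "a 3 \<le> lam 3"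
    using lam_less lam_pos[of 1] lam_pos[of 2] lam_pos[of 3] assms by auto
  show "growth w a lam = w {1, 2} UNIV * (a 2 - a 3) + w {1} UNIV * (a 1 - a 2) + w {} UNIV * (lam 3 - a 1)
      + w {} {1, 2} * (lam 2 - lam 3) + w {} {1} * (lam 1 - lam 2)" if "\<theta> * lam 1 \<le> lam 3"
  proof -
    have c: "a 1 \<le> lam 3" "a 2 \<le> lam 3" "a 1 \<le> lam 2" using that o by (auto simp: a_def)
    then show ?thesis using o by (simp add: growth_def overlap_def min_absorb1 min_absorb2 max_absorb1 max_absorb2)
  qed
  show "growth w a lam = w {1, 2} UNIV * (a 2 - a 3) + w {1} UNIV * (lam 3 - a 2) + w {1} {1, 2} * (a 1 - lam 3)
      + w {} {1, 2} * (lam 2 - a 1) + w {} {1} * (lam 1 - lam 2)"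
    if "lam 3 \<le> \<theta> * lam 1" "\<theta> * lam 2 \<le> lam 3" "\<theta> * lam 1 \<le> lam 2"
    using that[folded a_def] that o
    by (simp add: growth_def overlap_def min_absorb1 min_absorb2 max_absorb1 max_absorb2 a_def)
  show "growth w a lam = w {1, 2} UNIV * (lam 3 - a 3) + w {1} {1, 2} * (a 1 - a 2)
      + w {} {1, 2} * (lam 2 - a 1) + w {} {1} * (lam 1 - lam 2)"
    if "lam 3 \<le> \<theta> * lam 2" "\<theta> * lam 1 \<le> lam 2"
  proof -
    have c: "lam 3 \<le> a 2" "a 1 \<le> lam 2" "lam 3 \<le> a 1" using that o by (auto simp: a_def)
    then show ?thesis using o by (simp add: growth_def overlap_def min_absorb1 min_absorb2 max_absorb1 max_absorb2)
  qed
  show "growth w a lam = (1 - \<theta>) * split_value w" if "lam 3 \<le> \<theta> * lam 2" "lam 2 \<le> \<theta> * lam 1"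
  proof -
    have c: "lam 3 \<le> a 2" "lam 2 \<le> a 1" "lam 3 \<le> a 1" using that o by (auto simp: a_def)
    then have "growth w a lam = w {1, 2} UNIV * (lam 3 - a 3) + w {1} {1, 2} * (lam 2 - a 2) + w {} {1} * (lam 1 - a 1)"
      using o by (simp add: growth_def overlap_def min_absorb1 min_absorb2 max_absorb1 max_absorb2)
    then show ?thesis by (simp add: split_value_def a_def algebra_simps)
  qed
qed

lemma growth_zero:
  "growth w (\<lambda>_. 0) lam = w {} UNIV * lam 3 + w {} {1, 2} * (lam 2 - lam 3) + w {} {1} * (lam 1 - lam 2)"
  using lam_less lam_pos[of 2] lam_pos[of 3]
  by (simp add: growth_def overlap_def min_absorb1 min_absorb2 max_absorb1 max_absorb2)

lemma spectrum_formulas: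
  fixes C M N :: nat and w :: "3 set \<Rightarrow> 3 set \<Rightarrow> real"
  assumes \<theta>: "0 < \<theta>" "\<theta> < 1"
    and w: "w {} {1} = ln (card (proj1 D))" "w {} {1, 2} = ln (card (proj2 D))" "w {} UNIV = ln (card D)"
      "w {1} {1, 2} = ln M" "w {1} UNIV = ln C" "w {1, 2} UNIV = ln N"
    and pos: "1 \<le> C" "1 \<le> M" "1 \<le> N"
  shows "\<theta> * lam 1 \<le> lam 3 \<Longrightarrow> spectrum_value w \<theta> = spectrum_formula1 n D C N \<theta>"
    and "lam 3 \<le> \<theta> * lam 1 \<Longrightarrow> \<theta> * lam 2 \<le> lam 3 \<Longrightarrow> \<theta> * lam 1 \<le> lam 2 \<Longrightarrow>
      spectrum_value w \<theta> = spectrum_formula2 n D C M N \<theta>"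
    and "lam 3 \<le> \<theta> * lam 2 \<Longrightarrow> \<theta> * lam 1 \<le> lam 2 \<Longrightarrow> spectrum_value w \<theta> = spectrum_formula4 n D M N \<theta>"
proof -
  have cards: "1 \<le> card (proj1 D)" "1 \<le> card (proj2 D)" "1 \<le> card D"
    using max_ext_ge_1 max_ext_values by metis+
  have ln_quot: "ln (real p / real q) = ln p - ln q" if "1 \<le> p" "1 \<le> q" for p q :: nat
    using that by (simp add: ln_divide_pos)
  have div_lam: "x / ln (real (n q)) = x * lam q" for x q by (simp add: lam_def)
  have box: "box_dim (sponge n D) = ln (card D) * lam 3 + ln (card (proj2 D)) * (lam 2 - lam 3)
      + ln (card (proj1 D)) * (lam 1 - lam 2)"
    unfolding box_dim_sponge growth_zero log_max_def max_ext_values ..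
  show "spectrum_value w \<theta> = spectrum_formula1 n D C N \<theta>" if "\<theta> * lam 1 \<le> lam 3"
    unfolding spectrum_value_def spectrum_formula1_def growth_regimes(1)[OF \<theta> that] box w div_lam
      ln_quot[OF cards(3) pos(1)] ln_quot[OF pos(1,3)]
    by (rule arg_cong[where f = "\<lambda>x. x / (1 - \<theta>)"]) (simp add: algebra_simps)
  show "spectrum_value w \<theta> = spectrum_formula2 n D C M N \<theta>"
    if "lam 3 \<le> \<theta> * lam 1" "\<theta> * lam 2 \<le> lam 3" "\<theta> * lam 1 \<le> lam 2"
    unfolding spectrum_value_def spectrum_formula2_def growth_regimes(2)[OF \<theta> that] w div_lam
      ln_quot[OF cards(2,1)] ln_quot[OF pos(1,2)] ln_quot[OF cards(2) pos(2)] ln_quot[OF pos(1,3)]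
    by (rule arg_cong[where f = "\<lambda>x. x / (1 - \<theta>)"]) (simp add: algebra_simps)
  show "spectrum_value w \<theta> = spectrum_formula4 n D M N \<theta>"
    if "lam 3 \<le> \<theta> * lam 2" "\<theta> * lam 1 \<le> lam 2"
  proof -
    \<comment> \<open>The last summand of the formula stands outside the fraction and is brought
      over \<open>1 - \<theta>\<close>.\<close>
    have "x = x * (1 - \<theta>) / (1 - \<theta>)" for x using \<theta> by simp
    note this[of "ln (real N) * lam 3"]
    then show ?thesis
      unfolding spectrum_value_def spectrum_formula4_def growth_regimes(3)[OF \<theta> that] w div_lam
        ln_quot[OF cards(2,1)] ln_quot[OF cards(2) pos(2)]
      using \<theta> by (simp add: divide_simps) (simp add: algebra_simps)
  qed
qed

theorem spectra_sponge:
  assumes \<theta>: "0 < \<theta>" "\<theta> < 1" and gap: "lam 3 * lam 1 < lam 2 * lam 2"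
  shows "assouad_spectrum \<theta> (sponge n D) =
      (if \<theta> * lam 1 \<le> lam 3 then f1 n D \<theta>
       else if \<theta> * lam 2 \<le> lam 3 then f2 n D \<theta>
       else if \<theta> * lam 1 \<le> lam 2 then f4 n D \<theta>
       else assouad_dim (sponge n D))"
    and "lower_spectrum \<theta> (sponge n D) =
      (if \<theta> * lam 1 \<le> lam 3 then g1 n D \<theta>
       else if \<theta> * lam 2 \<le> lam 3 then g2 n D \<theta>
       else if \<theta> * lam 1 \<le> lam 2 then g4 n D \<theta>
       else lower_dim (sponge n D))"
proof -
  \<comment> \<open>The gap says lam 3 / lam 2 < lam 2 / lam 1, which orders the thresholds and
    places the second regime below the last.\<close>
  have mid: "\<theta> * lam 1 \<le> lam 2" if "\<theta> * lam 2 \<le> lam 3"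
  proof -
    have "\<theta> * lam 1 * lam 2 \<le> lam 3 * lam 1"
      using mult_right_mono[OF that, of "lam 1"] lam_pos[of 1] by (simp add: mult_ac)
    then have "\<theta> * lam 1 * lam 2 \<le> lam 2 * lam 2" using gap by linarith
    then show ?thesis using lam_pos[of 2] by simp
  qed
  have pos_max: "1 \<le> C_max D" "1 \<le> M_max D" "1 \<le> N_max D"
    using max_ext_ge_1 max_ext_values by metis+
  have pos_min: "1 \<le> C_min D" "1 \<le> M_min D" "1 \<le> N_min D"
    using min_ext_ge_1 min_ext_values by metis+
  note max_formulas = spectrum_formulas[of \<theta> log_max "M_max D" "C_max D" "N_max D", OF \<theta> _ _ _ _ _ _ pos_max,
      unfolded log_max_def max_ext_values, OF refl refl refl refl refl refl,
      folded log_max_def f1_def f2_def f4_def]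
  note min_formulas = spectrum_formulas[of \<theta> log_min "M_min D" "C_min D" "N_min D", OF \<theta> _ _ _ _ _ _ pos_min,
      unfolded log_min_def min_ext_values, OF refl refl refl refl refl refl,
      folded log_min_def g1_def g2_def g4_def]
  \<comment> \<open>This is the last regime; the equality is also the premise under which the
    Assouad and lower dimensions were computed.\<close>
  have split: "spectrum_value w \<theta> = split_value w" if "lam 3 \<le> \<theta> * lam 2" "lam 2 \<le> \<theta> * lam 1" for w
    using growth_regimes(4)[OF \<theta> that, of w] \<theta> by (simp add: spectrum_value_def)
  show "assouad_spectrum \<theta> (sponge n D) =
      (if \<theta> * lam 1 \<le> lam 3 then f1 n D \<theta>
       else if \<theta> * lam 2 \<le> lam 3 then f2 n D \<theta>
       else if \<theta> * lam 1 \<le> lam 2 then f4 n D \<theta>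
       else assouad_dim (sponge n D))"
    unfolding assouad_spectrum_sponge[OF \<theta>]
    using max_formulas mid split assouad_dim_sponge[OF \<theta>] by (simp add: f1_def f2_def f4_def)
  show "lower_spectrum \<theta> (sponge n D) =
      (if \<theta> * lam 1 \<le> lam 3 then g1 n D \<theta>
       else if \<theta> * lam 2 \<le> lam 3 then g2 n D \<theta>
       else if \<theta> * lam 1 \<le> lam 2 then g4 n D \<theta>
       else lower_dim (sponge n D))"
    unfolding lower_spectrum_sponge[OF \<theta>]
    using min_formulas mid split lower_dim_sponge[OF \<theta>] by (simp add: g1_def g2_def g4_def)
qed

end

theorem theorem3p3:
  fixes n :: "3 \<Rightarrow> nat" and D :: "(3 \<Rightarrow> nat) set" and F :: "(real ^ 3) set"
  assumes "2 \<le> n 1" and "n 1 < n 2" and "n 2 < n 3"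
    and "ln (n 2) / ln (n 3) < ln (n 1) / ln (n 2)"
    and "D \<subseteq> digit_box n" and "card D \<ge> 2"
    and "F = sponge n D"
    and "\<not> uniform_fibres D"
  shows "(\<forall>\<theta>. 0 < \<theta> \<and> \<theta> < 1 \<longrightarrow>
            assouad_spectrum \<theta> F =
              (if \<theta> \<le> ln (n 1) / ln (n 3) then f1 n D \<theta>
               else if \<theta> \<le> ln (n 2) / ln (n 3) then f2 n D \<theta>
               else if \<theta> \<le> ln (n 1) / ln (n 2) then f4 n D \<theta>
               else assouad_dim F)) \<and>
         (\<forall>\<theta>. 0 < \<theta> \<and> \<theta> < 1 \<longrightarrow>
            lower_spectrum \<theta> F =
              (if \<theta> \<le> ln (n 1) / ln (n 3) then g1 n D \<theta>
               else if \<theta> \<le> ln (n 2) / ln (n 3) then g2 n D \<theta>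
               else if \<theta> \<le> ln (n 1) / ln (n 2) then g4 n D \<theta>
               else lower_dim F))"
proof -
  have n_ge: "2 \<le> n q" for q using exhaust_3[of q] assms(1-3) by auto
  interpret digit_system3 n D
    using n_ge assms by unfold_locales auto
  have pos: "0 < ln (real (n 1))" "0 < ln (real (n 2))" "0 < ln (real (n 3))" by (rule ln_n_pos)+
  have cond: "\<theta> \<le> ln (n p) / ln (n q) \<longleftrightarrow> \<theta> * lam p \<le> lam q" for \<theta> p q
    using ln_n_pos[of p] ln_n_pos[of q] by (simp add: lam_def field_simps)
  have "lam 3 * lam 1 < lam 2 * lam 2"
    using assms(4) pos by (simp add: lam_def field_simps)
  from spectra_sponge[OF _ _ this] show ?thesis
    unfolding assms(7) cond by blast
qed

end
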